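(* Let $A\in \mathrm{M}_{n-1}\mathbb{R}$, let $\eta$ be one of the three matrices (a), (b), (c) of the context, and let $g_{A,\eta}$ be the corresponding Lorentzian metric on $\mathbb{R}^n$. Decompose $A$ as in the context, with $d\in\{0,1\}$ in case (c). Then $g_{A,\eta}$ is Ricci-flat if and only if: (a) in case (a): $S=O$; (b) in case (b): $\mathrm{tr}\,S_L=\mathrm{tr}\,S_L^2=0$ and, up to isometry, $T_L=O$ (that is, $g_{A,\eta}$ is isometric to $g_{S_L,\eta}$); (c) in case (c): $\bm{b}=\bm{0}$, together with $S'=O$ if $d=0$, and with $\mathrm{tr}\,S'^2=\mathrm{tr}\,S'$ if $d=1$.
   Context: $\mathrm{M}_m\mathbb{R}$ is the set of real $m\times m$ matrices. Consider the following symmetric $n\times n$ matrices: (a) $\eta=\mathrm{Diag}(1,\dots,1,-1)$; (b) $\eta=\mathrm{Diag}(-1,1,\dots,1)$; (c) $\eta=I_{n-2}\oplus\begin{bmatrix}0&1\\1&0\end{bmatrix}$. For $A\in\mathrm{M}_{n-1}\mathbb{R}$, the metric $g_{A,\eta}$ on $\mathbb{R}^n$ with coordinates $x_1,\dots,x_n$ is $$g_{A,\eta}=d\bm{x}^T\begin{bmatrix} e^{-A^Tx_n}&\bm 0\\ \bm 0^T&1\end{bmatrix}\eta\begin{bmatrix} e^{-Ax_n}&\bm 0\\ \bm 0^T&1\end{bmatrix}d\bm{x},\qquad d\bm{x}=(dx_1,\dots,dx_n)^T.$$ It is the general left-invariant Lorentzian metric of a simply connected almost abelian Lie group (a group whose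 Lie algebra has basis $X_1,\dots,X_n$ with $[X_i,X_j]=0$ and $[X_n,X_j]=\sum_i A^i_jX_i$ for $i,j\le n-1$). Decompositions of $A$. Case (a): $A=S+T$ with $S$ symmetric and $T$ skew-symmetric. Case (b): with $J=\mathrm{Diag}(-1,1,\dots,1)\in\mathrm{M}_{n-1}\mathbb{R}$, $A=S_L+T_L$ is the unique decomposition with $S_L^T=JS_LJ$ and $T_L^T=-JT_LJ$. Case (c): $A=\begin{bmatrix}A'&\bm b\\ \bm c^T&d\end{bmatrix}$ with $A'\in\mathrm{M}_{n-2}\mathbb{R}$, $\bm b,\bm c\in\mathbb{R}^{n-2}$, $d\in\mathbb{R}$, and $A'=S'+T'$ with $S'$ symmetric and $T'$ skew-symmetric. In case (c), up to isometry one may always normalize $d\in\{0,1\}$. *)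

theory Defs
  imports "HOL-Analysis.Analysis"
begin

section \<open>Ricci curvature and isometries of metrics on Euclidean space\<close>

text \<open>
  A (pseudo-Riemannian) metric on \<open>\<real>\<^sup>n\<close> is given by its matrix of components in the
  standard global coordinates, as a function of the point. Only one chart is needed.
\<close>

definition partial :: "'n::finite \<Rightarrow> (real^'n \<Rightarrow> real) \<Rightarrow> real^'n \<Rightarrow> real" where
  "partial i f x = frechet_derivative f (at x) (axis i 1)"

definition christoffel ::
    "(real^'n::finite \<Rightarrow> real^'n^'n) \<Rightarrow> 'n \<Rightarrow> 'n \<Rightarrow> 'n \<Rightarrow> real^'n \<Rightarrow> real" where
  "christoffel g i j k x =
     (\<Sum>l\<in>UNIV. matrix_inv (g x) $ i $ l *
        (partial j (\<lambda>y. g y $ l $ k) x + partial k (\<lambda>y. g y $ l $ j) x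
         - partial l (\<lambda>y. g y $ j $ k) x)) / 2"

text \<open>
  \<open>riemann g i j k l\<close> is \<open>R\<^sup>i\<^sub>j\<^sub>k\<^sub>l\<close>, that is,
  \<open>R(\<partial>\<^sub>k, \<partial>\<^sub>l)\<partial>\<^sub>j = \<Sum>\<^sub>i R\<^sup>i\<^sub>j\<^sub>k\<^sub>l \<partial>\<^sub>i\<close>
  for \<open>R(X, Y) = [\<nabla>\<^sub>X, \<nabla>\<^sub>Y] - \<nabla>\<^bsub>[X, Y]\<^esub>\<close>
  and the Levi-Civita connection \<open>\<nabla>\<close>.
\<close>

definition riemann ::
    "(real^'n::finite \<Rightarrow> real^'n^'n) \<Rightarrow> 'n \<Rightarrow> 'n \<Rightarrow> 'n \<Rightarrow> 'n \<Rightarrow> real^'n \<Rightarrow> real" where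
  "riemann g i j k l x =
     partial k (christoffel g i l j) x - partial l (christoffel g i k j) x
     + (\<Sum>p\<in>UNIV. christoffel g i k p x * christoffel g p l j x
                  - christoffel g i l p x * christoffel g p k j x)"

definition ricci :: "(real^'n::finite \<Rightarrow> real^'n^'n) \<Rightarrow> real^'n \<Rightarrow> real^'n^'n" where
  "ricci g x = (\<chi> j l. \<Sum>i\<in>UNIV. riemann g i j i l x)"

definition ricci_flat :: "(real^'n::finite \<Rightarrow> real^'n^'n) \<Rightarrow> bool" where
  "ricci_flat g \<longleftrightarrow> (\<forall>x. ricci g x = 0)"

primrec C_k :: "nat \<Rightarrow> (real^'n::finite \<Rightarrow> real) \<Rightarrow> bool" where
  "C_k 0 f \<longleftrightarrow> continuous_on UNIV f"
| "C_k (Suc k) f \<longleftrightarrow> (\<forall>x. f differentiable (at x)) \<and> (\<forall>i. C_k k (partial i f))"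

definition smooth_map :: "(real^'n::finite \<Rightarrow> real^'m::finite) \<Rightarrow> bool" where
  "smooth_map \<phi> \<longleftrightarrow> (\<forall>i k. C_k k (\<lambda>x. \<phi> x $ i))"

definition diffeomorphism :: "(real^'n::finite \<Rightarrow> real^'n) \<Rightarrow> bool" where
  "diffeomorphism \<phi> \<longleftrightarrow> bij \<phi> \<and> smooth_map \<phi> \<and> smooth_map (inv \<phi>)"

definition pullback ::
    "(real^'n::finite \<Rightarrow> real^'n) \<Rightarrow> (real^'n \<Rightarrow> real^'n^'n) \<Rightarrow> real^'n \<Rightarrow> real^'n^'n" where
  "pullback \<phi> h x = transpose (jacobian \<phi> (at x)) ** h (\<phi> x) ** jacobian \<phi> (at x)"

definition isometric ::
    "(real^'n::finite \<Rightarrow> real^'n^'n) \<Rightarrow> (real^'n \<Rightarrow> real^'n^'n) \<Rightarrow> bool" where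
  "isometric g h \<longleftrightarrow> (\<exists>\<phi>. diffeomorphism \<phi> \<and> pullback \<phi> h = g)"


section \<open>The left-invariant metrics\<close>

text \<open>
  The index set \<open>{1, \<dots>, n - 1}\<close> is a finite linearly ordered type \<open>'m\<close>, so that
  \<open>n = CARD('m) + 1 \<ge> 2\<close> is arbitrary; \<open>'m option\<close> is the index set \<open>{1, \<dots>, n}\<close>, where
  \<open>None\<close> stands for \<open>n\<close> (no order on \<open>'m option\<close> is used).
\<close>

definition first_index :: "'m::{finite,linorder}" where
  "first_index = Min UNIV"

definition last_index :: "'m::{finite,linorder}" where
  "last_index = Max UNIV"

primrec matrix_power :: "real^'m^'m \<Rightarrow> nat \<Rightarrow> real^'m^'m::finite" where
  "matrix_power A 0 = mat 1"
| "matrix_power A (Suc k) = A ** matrix_power A k"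

definition matrix_exp :: "real^'m^'m \<Rightarrow> real^'m^'m::finite" where
  "matrix_exp A = (\<Sum>k. (1 / fact k) *\<^sub>R matrix_power A k)"

text \<open>The block matrix with diagonal blocks \<open>B\<close> and \<open>1\<close>.\<close>

definition extend_by_one :: "real^'m^'m \<Rightarrow> real^('m::finite option)^('m::finite option)" where
  "extend_by_one B = (\<chi> i j. case (i, j) of
       (Some i', Some j') \<Rightarrow> B $ i' $ j'
     | (None, None) \<Rightarrow> 1
     | _ \<Rightarrow> 0)"

definition almost_abelian_metric ::
    "real^'m^'m \<Rightarrow> real^('m::finite option)^('m::finite option) \<Rightarrow> real^('m::finite option)
       \<Rightarrow> real^('m::finite option)^('m::finite option)" where
  "almost_abelian_metric A \<eta> x =
     extend_by_one (matrix_exp (- (x $ None) *\<^sub>R transpose A)) ** \<eta> **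
     extend_by_one (matrix_exp (- (x $ None) *\<^sub>R A))"

definition \<eta>_a :: "real^('m::finite option)^('m::finite option)" where
  "\<eta>_a = (\<chi> i j. if i = j then (if i = None then -1 else 1) else 0)"

definition \<eta>_b :: "real^('m::{finite,linorder} option)^('m::{finite,linorder} option)" where
  "\<eta>_b = (\<chi> i j. if i = j then (if i = Some first_index then -1 else 1) else 0)"

definition \<eta>_c :: "real^('m::{finite,linorder} option)^('m::{finite,linorder} option)" where
  "\<eta>_c = (\<chi> i j.
     if i \<in> {Some last_index, None} \<or> j \<in> {Some last_index, None}
     then (if (i, j) \<in> {(Some last_index, None), (None, Some last_index)} then 1 else 0)
     else (if i = j then 1 else 0))"

definition J_minkowski :: "real^'m::{finite,linorder}^'m::{finite,linorder}" where
  "J_minkowski = (\<chi> i j. if i = j then (if i = first_index then -1 else 1) else 0)"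

text \<open>
  The blocks \<open>A'\<close>, \<open>b\<close>, \<open>d\<close> of \<open>A\<close> in the last case. The matrices of size \<open>n - 2\<close> (possibly
  \<open>0\<close>) are identified with the matrices of size \<open>n - 1\<close> whose last row and column vanish,
  and the vectors of length \<open>n - 2\<close> with the vectors whose last entry vanishes. This preserves
  sums, products, transposes, traces and zero.
\<close>

definition upper_left_block ::
    "real^'m::{finite,linorder}^'m::{finite,linorder}
       \<Rightarrow> real^'m::{finite,linorder}^'m::{finite,linorder}" where
  "upper_left_block A =
     (\<chi> i j. if i \<noteq> last_index \<and> j \<noteq> last_index then A $ i $ j else 0)"

definition upper_right_block ::
    "real^'m::{finite,linorder}^'m::{finite,linorder} \<Rightarrow> real^'m::{finite,linorder}" where
  "upper_right_block A = (\<chi> i. if i \<noteq> last_index then A $ i $ last_index else 0)"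

definition corner_entry :: "real^'m::{finite,linorder}^'m::{finite,linorder} \<Rightarrow> real" where
  "corner_entry A = A $ last_index $ last_index"

end

theory Submission
  imports Defs
begin

text \<open>
  Write \<open>F = e\<^bsup>-tA\<^esup> \<oplus> 1\<close> with \<open>t = x\<^sub>n\<close>, so that the metric is \<open>G(t) = F\<^sup>T \<eta> F\<close>. Since \<open>G\<close> depends on
  \<open>t\<close> only and \<open>G' = - G B\<close> with \<open>B = F\<^sup>-\<^sup>1 B\<^sub>0 F\<close>, \<open>N = A \<oplus> 0\<close>, \<open>B\<^sub>0 = N + \<eta> N\<^sup>T \<eta>\<close>, the Christoffel
  symbols are linear in the entries of \<open>B\<close> and the Ricci tensor is \<open>F\<^sup>T Q F / 2\<close> for a constant
  symmetric matrix \<open>Q\<close>. With \<open>e = e\<^sub>n\<close>, \<open>\<tau> = tr A\<close>, \<open>\<rho> = B\<^sub>0\<^sup>T e\<close> and \<open>\<epsilon> = \<eta>\<^sub>n\<^sub>n\<close>,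
  \<open>Q = e \<rho>\<^sup>T (N + \<tau>) + (N + \<tau>)\<^sup>T \<rho> e\<^sup>T + \<epsilon> \<eta> ([N, B\<^sub>0] - \<tau> B\<^sub>0) - tr(B\<^sub>0\<^sup>2) e e\<^sup>T / 2 - \<rho> \<rho>\<^sup>T\<close>.

  In cases (a) and (b), \<open>\<rho> = 0\<close> and \<open>Q = 0\<close> says that the self-adjoint part \<open>S\<close> of \<open>A\<close> satisfies
  \<open>tr S = tr S\<^sup>2 = 0\<close> and commutes with the skew part; \<open>e\<^bsup>-tA\<^esup>\<close> then factors and the metric equals that of
  \<open>S\<close>. The converse in (b) needs that the Ricci tensor is natural under diffeomorphisms. In case (c),
  \<open>\<epsilon> = 0\<close> and \<open>\<rho> = (b, 0, d)\<close>, so \<open>Q = 0\<close> forces \<open>b = 0\<close>, and then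
  \<open>Q = 2 (d tr S' - tr S'\<^sup>2) e e\<^sup>T\<close>.
\<close>

section \<open>The matrix exponential\<close>

lemma bounded_bilinear_matrix_mult:
  "bounded_bilinear ((**) :: real^'n^'m \<Rightarrow> real^'p^'n \<Rightarrow> real^'p^'m)"
  by (intro bilinear_conv_bounded_bilinear[THEN iffD1])
     (auto simp: bilinear_def matrix_matrix_mult_def vec_eq_iff algebra_simps sum.distrib
        sum_distrib_left intro!: linearI)

lemmas matrix_mult_has_vector_derivative =
  bounded_bilinear.has_vector_derivative[OF bounded_bilinear_matrix_mult]

lemma matrix_mult_scaleR_left [simp]:
  fixes A :: "real^'n^'m" shows "(c *\<^sub>R A) ** B = c *\<^sub>R (A ** B)"
  by (rule bounded_bilinear.scaleR_left[OF bounded_bilinear_matrix_mult])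

lemma matrix_mult_scaleR_right [simp]:
  fixes A :: "real^'n^'m" shows "A ** (c *\<^sub>R B) = c *\<^sub>R (A ** B)"
  by (rule bounded_bilinear.scaleR_right[OF bounded_bilinear_matrix_mult])

lemma matrix_mult_minus_left [simp]:
  fixes A :: "real^'n^'m" shows "(- A) ** B = - (A ** B)"
  by (rule bounded_bilinear.minus_left[OF bounded_bilinear_matrix_mult])

lemma matrix_mult_minus_right [simp]:
  fixes A :: "real^'n^'m" shows "A ** (- B) = - (A ** B)"
  by (rule bounded_bilinear.minus_right[OF bounded_bilinear_matrix_mult])

lemma matrix_mult_add_left:
  fixes A B :: "real^'n^'m" shows "(A + B) ** C = A ** C + B ** C"
  by (rule bounded_bilinear.add_left[OF bounded_bilinear_matrix_mult])

lemma matrix_mult_diff_left: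
  fixes A B :: "real^'n^'m" shows "(A - B) ** C = A ** C - B ** C"
  by (rule bounded_bilinear.diff_left[OF bounded_bilinear_matrix_mult])

lemma matrix_mult_diff_right:
  fixes A :: "real^'n^'m" shows "A ** (B - C) = A ** B - A ** C"
  by (rule bounded_bilinear.diff_right[OF bounded_bilinear_matrix_mult])

lemma transpose_nth: "transpose A $ i $ j = A $ j $ i"
  by (simp add: transpose_def)

lemma transpose_add [simp]: "transpose (A + B) = transpose A + transpose (B :: real^'n^'m)"
  by (simp add: transpose_def vec_eq_iff)

lemma transpose_diff [simp]: "transpose (A - B) = transpose A - transpose (B :: real^'n^'m)"
  by (simp add: transpose_def vec_eq_iff)

lemma transpose_minus [simp]: "transpose (- A) = - transpose (A :: real^'n^'m)"
  by (simp add: transpose_def vec_eq_iff)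

lemma transpose_scaleR [simp]: "transpose (c *\<^sub>R A) = c *\<^sub>R transpose (A :: real^'n^'m)"
  by (simp add: transpose_def vec_eq_iff)

lemma trace_minus [simp]: "trace (- A) = - trace (A :: real^'n^'n)"
  by (simp add: trace_def sum_negf)

lemma trace_scaleR [simp]: "trace (c *\<^sub>R A) = c * trace (A :: real^'n^'n)"
  by (simp add: trace_def sum_distrib_left)

lemma trace_transpose [simp]: "trace (transpose A) = trace (A :: real^'n^'n)"
  by (simp add: trace_def transpose_def)

text \<open>For square matrices a left inverse is also a right inverse, so the choice in
  \<open>matrix_inv\<close> has a witness, and associativity forces the chosen matrix to be
  \<open>B\<close>.\<close>

lemma matrix_inv_eqI:
  fixes A B :: "real^'n^'n"
  assumes "B ** A = mat 1"
  shows "matrix_inv A = B"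
proof -
  have AB: "A ** B = mat 1" using assms by (simp add: matrix_left_right_inverse)
  have "A ** matrix_inv A = mat 1 \<and> matrix_inv A ** A = mat 1"
    unfolding matrix_inv_def by (rule someI[of _ B]) (simp add: AB assms)
  then have "B ** (A ** matrix_inv A) = B" by simp
  then show ?thesis by (simp add: matrix_mul_assoc assms)
qed

section \<open>Entrywise differentiation of matrix-valued curves\<close>

lemma has_vector_derivative_vec_iff:
  fixes f :: "real \<Rightarrow> ('a::euclidean_space)^'n"
  shows "(f has_vector_derivative f') (at t) \<longleftrightarrow>
    (\<forall>i. ((\<lambda>t. f t $ i) has_vector_derivative f' $ i) (at t))"
proof
  assume "(f has_vector_derivative f') (at t)"
  then show "\<forall>i. ((\<lambda>t. f t $ i) has_vector_derivative f' $ i) (at t)"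
    by (auto intro!: bounded_linear.has_vector_derivative[OF bounded_linear_vec_nth])
next
  assume *: "\<forall>i. ((\<lambda>t. f t $ i) has_vector_derivative f' $ i) (at t)"
  show "(f has_vector_derivative f') (at t)"
    unfolding has_vector_derivative_def
  proof (subst has_derivative_componentwise_within, safe)
    fix b :: "'a^'n" assume "b \<in> Basis"
    then obtain i u where "b = axis i u" by (auto simp: Basis_vec_def)
    moreover have "((\<lambda>t. f t $ i \<bullet> u) has_derivative (\<lambda>x. (x *\<^sub>R f' $ i) \<bullet> u)) (at t)"
      using * unfolding has_vector_derivative_def
      by (intro bounded_linear.has_derivative[OF bounded_linear_inner_left]) auto
    ultimately show "((\<lambda>t. f t \<bullet> b) has_derivative (\<lambda>x. (x *\<^sub>R f') \<bullet> b)) (at t)"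
      by (simp add: inner_axis)
  qed
qed

lemma has_vector_derivative_matrix_iff:
  fixes f :: "real \<Rightarrow> real^'n^'m"
  shows "(f has_vector_derivative f') (at t) \<longleftrightarrow>
    (\<forall>i j. ((\<lambda>t. f t $ i $ j) has_real_derivative f' $ i $ j) (at t))"
  by (simp add: has_vector_derivative_vec_iff has_real_derivative_iff_has_vector_derivative)

lemma transpose_has_vector_derivative:
  fixes f :: "real \<Rightarrow> real^'n^'m"
  assumes "(f has_vector_derivative f') (at t)"
  shows "((\<lambda>t. transpose (f t)) has_vector_derivative transpose f') (at t)"
  using assms by (simp add: has_vector_derivative_matrix_iff transpose_def)

text \<open>Identities between exponentials are obtained from this by differentiating a product and
  comparing it with its value at \<open>0\<close>.\<close>

lemma matrix_derivative_zero_constant: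
  fixes f :: "real \<Rightarrow> real^'n^'m"
  assumes "\<And>t. (f has_vector_derivative 0) (at t)"
  shows "f s = f t"
  by (rule has_derivative_zero_unique[of UNIV])
     (use assms in \<open>auto simp: has_vector_derivative_def\<close>)

section \<open>Powers and the exponential series\<close>

lemma matrix_power_scaleR: "matrix_power (c *\<^sub>R A) k = c ^ k *\<^sub>R matrix_power A k"
  by (induction k) auto

lemma matrix_power_intertwines:
  "B ** A = A' ** B \<Longrightarrow> B ** matrix_power A k = matrix_power A' k ** B"
  by (induction k) (auto, metis matrix_mul_assoc)

lemma transpose_matrix_power: "transpose (matrix_power A k) = matrix_power (transpose A) k"
proof (induction k)
  case (Suc k)
  have "transpose (matrix_power A (Suc k)) = matrix_power (transpose A) k ** transpose A"
    by (simp add: matrix_transpose_mul Suc)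
  also have "\<dots> = transpose A ** matrix_power (transpose A) k"
    by (rule matrix_power_intertwines[symmetric]) simp
  finally show ?case by simp
qed (simp add: transpose_mat)

text \<open>Boundedness of the product gives a submultiplicative estimate up to a constant
  \<open>K\<close>, so the terms are dominated by the scalar exponential series of
  \<open>norm A * K\<close>; the factor \<open>c\<close> is the norm of the identity matrix.\<close>

lemma summable_matrix_exp: "summable (\<lambda>k. (1 / fact k) *\<^sub>R matrix_power (A :: real^'n^'n) k)"
proof -
  obtain K where K: "K > 0" "\<And>(A :: real^'n^'n) (B :: real^'n^'n). norm (A ** B) \<le> norm A * norm B * K"
    using bounded_bilinear.pos_bounded[OF bounded_bilinear_matrix_mult] by blast
  define c where "c = norm (mat 1 :: real^'n^'n)"
  have pow: "norm (matrix_power A k) \<le> c * (norm A * K) ^ k" for k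
  proof (induction k)
    case (Suc k)
    have "norm (matrix_power A (Suc k)) \<le> norm A * norm (matrix_power A k) * K"
      using K(2) by simp
    also have "\<dots> \<le> norm A * (c * (norm A * K) ^ k) * K"
      using Suc K(1) by (intro mult_right_mono mult_left_mono) auto
    finally show ?case by (simp add: mult_ac)
  qed (simp add: c_def)
  show ?thesis
  proof (rule summable_comparison_test')
    show "summable (\<lambda>k. c * ((norm A * K) ^ k /\<^sub>R fact k))"
      by (intro summable_mult summable_exp_generic)
    fix k
    show "norm ((1 / fact k) *\<^sub>R matrix_power A k) \<le> c * ((norm A * K) ^ k /\<^sub>R fact k)"
      using mult_left_mono[OF pow[of k], of "1 / fact k"] by (simp add: field_simps)
  qed
qed

lemma bounded_linear_matrix_nth: "bounded_linear (\<lambda>A :: real^'n^'m. A $ i $ j)"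
  by (rule bounded_linear_compose[OF bounded_linear_vec_nth bounded_linear_vec_nth])

lemma matrix_exp_nth:
  "matrix_exp A $ i $ j = (\<Sum>k. matrix_power A k $ i $ j / fact k)"
  unfolding matrix_exp_def
  by (subst bounded_linear.suminf[OF bounded_linear_matrix_nth summable_matrix_exp]) simp

lemma summable_matrix_exp_nth: "summable (\<lambda>k. matrix_power A k $ i $ j / fact k)"
  using bounded_linear.summable[OF bounded_linear_matrix_nth summable_matrix_exp, of A i j] by simp

lemma matrix_mult_matrix_exp:
  "B ** matrix_exp A = (\<Sum>k. (1 / fact k) *\<^sub>R (B ** matrix_power A k))"
  unfolding matrix_exp_def
  using bounded_linear.suminf[OF bounded_bilinear.bounded_linear_right[OF bounded_bilinear_matrix_mult]
      summable_matrix_exp] by simp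

lemma matrix_exp_mult_matrix:
  "matrix_exp A ** B = (\<Sum>k. (1 / fact k) *\<^sub>R (matrix_power A k ** B))"
  unfolding matrix_exp_def
  using bounded_linear.suminf[OF bounded_bilinear.bounded_linear_left[OF bounded_bilinear_matrix_mult]
      summable_matrix_exp] by simp

text \<open>The relation passes from \<open>A\<close> to its powers and then to the series. With
  \<open>A' = A\<close> it expresses commutation; with \<open>B\<close> a quadratic form it moves an
  exponential across that form.\<close>

lemma matrix_exp_intertwines:
  assumes "B ** A = A' ** B"
  shows "B ** matrix_exp A = matrix_exp A' ** B"
  by (simp add: matrix_mult_matrix_exp matrix_exp_mult_matrix matrix_power_intertwines[OF assms])

lemma matrix_exp_0 [simp]: "matrix_exp (0 :: real^'n^'n) = mat 1"
proof -
  have "(1 / fact k) *\<^sub>R matrix_power (0 :: real^'n^'n) k = (if k = 0 then mat 1 else 0)" for k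
    by (cases k) auto
  then have "matrix_exp (0 :: real^'n^'n) = (\<Sum>k. if k = 0 then mat 1 else 0)"
    by (simp add: matrix_exp_def)
  then show ?thesis using suminf_finite[of "{0}" "\<lambda>k. if k = 0 then mat 1 else (0 :: real^'n^'n)"]
    by simp
qed

lemma transpose_matrix_exp: "transpose (matrix_exp A) = matrix_exp (transpose A)"
proof -
  have "transpose (matrix_exp A) $ i $ j = matrix_exp (transpose A) $ i $ j" for i j
    by (simp add: transpose_nth matrix_exp_nth transpose_matrix_power[symmetric])
  then show ?thesis by (simp add: vec_eq_iff)
qed

text \<open>Each entry is an everywhere convergent power series in \<open>t\<close>, which may be
  differentiated term by term.\<close>

lemma matrix_exp_has_vector_derivative:
  "((\<lambda>t. matrix_exp (t *\<^sub>R A)) has_vector_derivative A ** matrix_exp (t *\<^sub>R A)) (at t)"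
  unfolding has_vector_derivative_matrix_iff
proof (intro allI)
  fix i j
  define c where "c k = matrix_power A k $ i $ j / fact k" for k
  have s: "matrix_power (y *\<^sub>R A) k $ i $ j / fact k = c k * y ^ k" for k y
    by (simp add: matrix_power_scaleR c_def)
  have "((\<lambda>t. \<Sum>k. c k * t ^ k) has_real_derivative (\<Sum>k. diffs c k * t ^ k)) (at t)"
    using summable_matrix_exp_nth[of "_ *\<^sub>R A" i j] unfolding s
    by (rule termdiffs_strong_converges_everywhere)
  moreover have "(\<Sum>k. diffs c k * t ^ k) = (A ** matrix_exp (t *\<^sub>R A)) $ i $ j"
  proof -
    have "summable (\<lambda>k. (1 / fact k) *\<^sub>R (A ** matrix_power (t *\<^sub>R A) k))"
      using bounded_linear.summable[OF bounded_bilinear.bounded_linear_right[OF bounded_bilinear_matrix_mult]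
          summable_matrix_exp] by simp
    then have "(A ** matrix_exp (t *\<^sub>R A)) $ i $ j =
        (\<Sum>k. ((1 / fact k) *\<^sub>R (A ** matrix_power (t *\<^sub>R A) k)) $ i $ j)"
      unfolding matrix_mult_matrix_exp by (rule bounded_linear.suminf[OF bounded_linear_matrix_nth])
    \<comment> \<open>\<open>diffs c k\<close> is \<open>(k + 1) * c (k + 1)\<close>; the factor
      \<open>k + 1\<close> cancels against \<open>fact (k + 1)\<close> and leaves one extra factor
      \<open>A\<close> in the power.\<close>
    moreover have "diffs c k * t ^ k = ((1 / fact k) *\<^sub>R (A ** matrix_power (t *\<^sub>R A) k)) $ i $ j" for k
      by (simp add: diffs_def c_def matrix_power_scaleR del: of_nat_Suc)
    ultimately show ?thesis by simp
  qed
  ultimately show "((\<lambda>t. matrix_exp (t *\<^sub>R A) $ i $ j) has_real_derivative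
      (A ** matrix_exp (t *\<^sub>R A)) $ i $ j) (at t)"
    by (simp add: matrix_exp_nth s)
qed

text \<open>The product has derivative zero because \<open>A\<close> commutes with its own
  exponential, and it is the identity at \<open>t = 0\<close>.\<close>

lemma matrix_exp_minus: "matrix_exp (- t *\<^sub>R A) ** matrix_exp (t *\<^sub>R A) = mat 1"
proof -
  define f where "f t = matrix_exp (t *\<^sub>R (- A)) ** matrix_exp (t *\<^sub>R A)" for t
  have "(f has_vector_derivative 0) (at t)" for t
  proof -
    have c: "A ** matrix_exp (t *\<^sub>R (- A)) = matrix_exp (t *\<^sub>R (- A)) ** A"
      by (rule matrix_exp_intertwines) simp
    show ?thesis unfolding f_def
      using matrix_mult_has_vector_derivative[OF matrix_exp_has_vector_derivative[of "- A" t]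
          matrix_exp_has_vector_derivative[of A t]] c by (simp add: matrix_mul_assoc)
  qed
  then have "f t = f 0" by (rule matrix_derivative_zero_constant)
  then show ?thesis by (simp add: f_def)
qed

text \<open>The left side times the inverse of the right side has derivative zero: by commutation
  all generators can be collected in one place, where \<open>P + Q\<close> and
  \<open>- (P + Q)\<close> cancel.\<close>

lemma matrix_exp_add_commuting:
  assumes "P ** Q = Q ** P"
  shows "matrix_exp (t *\<^sub>R P) ** matrix_exp (t *\<^sub>R Q) = matrix_exp (t *\<^sub>R (P + Q))"
proof -
  define f where "f t = matrix_exp (t *\<^sub>R P) ** matrix_exp (t *\<^sub>R Q) ** matrix_exp (t *\<^sub>R (- (P + Q)))" for t
  have "(f has_vector_derivative 0) (at t)" for t
  proof -
    define p q r where "p = matrix_exp (t *\<^sub>R P)" "q = matrix_exp (t *\<^sub>R Q)"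
      "r = matrix_exp (t *\<^sub>R (- (P + Q)))"
    have c: "P ** p = p ** P" "P ** q = q ** P" "Q ** p = p ** Q" "Q ** q = q ** Q"
      unfolding p_q_r_def using assms by (auto intro!: matrix_exp_intertwines)
    have "(f has_vector_derivative (p ** q) ** (- (P + Q) ** r) + (p ** (Q ** q) + (P ** p) ** q) ** r) (at t)"
      unfolding f_def p_q_r_def
      by (intro matrix_mult_has_vector_derivative matrix_exp_has_vector_derivative)
    moreover have "(p ** q) ** (- (P + Q) ** r) + (p ** (Q ** q) + (P ** p) ** q) ** r = 0"
    proof -
      have "p ** (Q ** q) = p ** q ** Q" "(P ** p) ** q = p ** q ** P"
        by (metis c matrix_mul_assoc)+
      then show ?thesis
        by (simp add: matrix_add_ldistrib matrix_mult_add_left matrix_mul_assoc del: minus_add_distrib)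
    qed
    ultimately show ?thesis by simp
  qed
  then have "f t = f 0" by (rule matrix_derivative_zero_constant)
  then have "matrix_exp (t *\<^sub>R P) ** matrix_exp (t *\<^sub>R Q) ** matrix_exp (- t *\<^sub>R (P + Q)) = mat 1"
    by (simp add: f_def scaleR_diff_right scaleR_add_right)
  then have "matrix_exp (t *\<^sub>R P) ** matrix_exp (t *\<^sub>R Q) **
      (matrix_exp (- t *\<^sub>R (P + Q)) ** matrix_exp (t *\<^sub>R (P + Q))) = matrix_exp (t *\<^sub>R (P + Q))"
    by (metis matrix_mul_assoc matrix_mul_lid)
  then show ?thesis by (metis matrix_exp_minus matrix_mul_rid)
qed

section \<open>Ricci curvature of metrics depending on one coordinate\<close>

lemma partial_single_coordinate:
  assumes "(f has_real_derivative d) (at (x $ c))"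
  shows "partial i (\<lambda>y. f (y $ c)) x = (if i = c then d else 0)"
proof -
  have "((\<lambda>y. f (y $ c)) has_derivative (\<lambda>h. d * (h $ c))) (at x)"
    using has_derivative_compose[OF bounded_linear_imp_has_derivative[OF bounded_linear_vec_nth[of c]]
        assms[unfolded has_field_derivative_def]] .
  from frechet_derivative_at[OF this, symmetric] show ?thesis
    by (simp add: partial_def axis_def)
qed

text \<open>\<open>H\<close> is the inverse of \<open>G\<close> and \<open>B\<close> is minus its
  logarithmic derivative. Since \<open>B\<close> evolves by its commutator with the constant matrix
  \<open>N\<close>, second derivatives of the metric are again algebraic in \<open>G\<close>,
  \<open>B\<close> and \<open>N\<close>.\<close>

locale single_coordinate_metric =
  fixes G H B :: "real \<Rightarrow> real^'n^'n" and N :: "real^'n^'n" and c :: "'n::finite" and \<tau> \<epsilon> :: real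
  assumes inverse: "H t ** G t = mat 1"
    and sym: "transpose (G t) = G t" "transpose (G t ** B t) = G t ** B t"
    and deriv_G: "(G has_vector_derivative - (G t ** B t)) (at t)"
    and deriv_H: "(H has_vector_derivative B t ** H t) (at t)"
    and deriv_B: "(B has_vector_derivative N ** B t - B t ** N) (at t)"
    and corner: "H t $ c $ c = \<epsilon>"
    and row_N: "N $ c = 0"
    and trace_B: "trace (B t) = 2 * \<tau>"
begin

definition metric :: "real^'n \<Rightarrow> real^'n^'n" where "metric x = G (x $ c)"

definition \<delta> :: "'n \<Rightarrow> real" where "\<delta> i = (if i = c then 1 else 0)"

text \<open>This is minus the derivative of \<open>G\<close>, that is, \<open>B\<close> with its
  first index lowered.\<close>

definition K :: "real \<Rightarrow> real^'n^'n" where "K t = G t ** B t"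

text \<open>The Christoffel symbols as functions of the single coordinate. Only the derivative in
  direction \<open>c\<close> survives, hence the factors \<open>\<delta>\<close>, and the minus sign
  is that of \<open>G' = - K\<close>.\<close>

definition Chr :: "'n \<Rightarrow> 'n \<Rightarrow> 'n \<Rightarrow> real \<Rightarrow> real" where
  "Chr i j k t = (- 1 / 2) * (\<delta> j * B t $ i $ k + \<delta> k * B t $ i $ j - H t $ i $ c * K t $ j $ k)"

text \<open>The derivative of \<open>Chr\<close>, in the shape in which the product rule delivers
  it.\<close>

definition Chr' :: "'n \<Rightarrow> 'n \<Rightarrow> 'n \<Rightarrow> real \<Rightarrow> real" where
  "Chr' i j k t = (- 1 / 2) * (\<delta> j * (N ** B t - B t ** N) $ i $ k + \<delta> k * (N ** B t - B t ** N) $ i $ j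
      - ((B t ** H t) $ i $ c * K t $ j $ k
        + (G t ** (N ** B t - B t ** N) - K t ** B t) $ j $ k * H t $ i $ c))"

lemma sum_\<delta> [simp]: "(\<Sum>i\<in>UNIV. \<delta> i * f i) = f c" "(\<Sum>i\<in>UNIV. f i * \<delta> i) = f c"
  by (simp_all add: \<delta>_def if_distrib[of "\<lambda>x. x * _"] if_distrib[of "\<lambda>x. _ * x"] cong: if_cong)

lemma deriv_K: "(K has_vector_derivative G t ** (N ** B t - B t ** N) - K t ** B t) (at t)"
  unfolding K_def using matrix_mult_has_vector_derivative[OF deriv_G[of t] deriv_B[of t]] by simp

lemma Chr_has_derivative: "(Chr i j k has_real_derivative Chr' i j k t) (at t)"
proof -
  have B: "((\<lambda>t. B t $ i $ j) has_real_derivative (N ** B t - B t ** N) $ i $ j) (at t)" for i j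
    using deriv_B[of t] unfolding has_vector_derivative_matrix_iff by blast
  have H: "((\<lambda>t. H t $ i $ j) has_real_derivative (B t ** H t) $ i $ j) (at t)" for i j
    using deriv_H[of t] unfolding has_vector_derivative_matrix_iff by blast
  have K: "((\<lambda>t. K t $ i $ j) has_real_derivative (G t ** (N ** B t - B t ** N) - K t ** B t) $ i $ j) (at t)" for i j
    using deriv_K[of t] unfolding has_vector_derivative_matrix_iff by blast
  show ?thesis unfolding Chr_def[abs_def] Chr'_def
    by (intro DERIV_cmult DERIV_diff DERIV_add DERIV_mult B H K)
qed

lemma christoffel_metric: "christoffel metric i j k x = Chr i j k (x $ c)"
proof -
  define t where "t = x $ c"
  have d: "partial i (\<lambda>y. metric y $ j $ k) x = - \<delta> i * K t $ j $ k" for i j k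
  proof -
    have "((\<lambda>t. G t $ j $ k) has_real_derivative - K t $ j $ k) (at (x $ c))"
      using deriv_G[of t] unfolding has_vector_derivative_matrix_iff t_def K_def by simp
    then show ?thesis
      by (simp add: partial_single_coordinate[where f = "\<lambda>t. G t $ j $ k"] metric_def \<delta>_def)
  qed
  have inv: "matrix_inv (metric x) = H t"
    by (rule matrix_inv_eqI) (simp add: inverse metric_def t_def)
  \<comment> \<open>Raising the index of \<open>K\<close> recovers \<open>B\<close>; this evaluates
    the first two terms of the Christoffel sum.\<close>
  have HK: "(\<Sum>l\<in>UNIV. H t $ i $ l * K t $ l $ k) = B t $ i $ k" for i k
  proof -
    have "H t ** K t = B t" by (simp add: K_def matrix_mul_assoc inverse)
    then show ?thesis by (simp add: matrix_matrix_mult_def vec_eq_iff)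
  qed
  have "christoffel metric i j k x = (\<Sum>l\<in>UNIV. H t $ i $ l *
        (- \<delta> j * K t $ l $ k + - \<delta> k * K t $ l $ j - - \<delta> l * K t $ j $ k)) / 2"
    unfolding christoffel_def d inv ..
  also have "(\<Sum>l\<in>UNIV. H t $ i $ l *
        (- \<delta> j * K t $ l $ k + - \<delta> k * K t $ l $ j - - \<delta> l * K t $ j $ k)) =
      - \<delta> j * (\<Sum>l\<in>UNIV. H t $ i $ l * K t $ l $ k) - \<delta> k * (\<Sum>l\<in>UNIV. H t $ i $ l * K t $ l $ j)
      + (\<Sum>l\<in>UNIV. \<delta> l * (H t $ i $ l * K t $ j $ k))"
    unfolding sum_distrib_left sum_subtractf[symmetric] sum.distrib[symmetric]
    by (rule sum.cong) (auto simp: algebra_simps)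
  also have "\<dots> = - \<delta> j * B t $ i $ k - \<delta> k * B t $ i $ j + H t $ i $ c * K t $ j $ k"
    by (simp add: HK)
  finally show ?thesis by (simp add: Chr_def t_def field_simps)
qed

lemma partial_christoffel_metric:
  "partial l (christoffel metric i j k) x = \<delta> l * Chr' i j k (x $ c)"
  using partial_single_coordinate[OF Chr_has_derivative, where i = l and x = x and c = c]
  by (simp add: christoffel_metric[abs_def] \<delta>_def cong: if_cong)

lemma K_sym: "K t $ i $ j = K t $ j $ i"
  using arg_cong[OF sym(2), of "\<lambda>M. M $ j $ i"] by (simp add: K_def transpose_nth)

lemma GH: "G t ** H t = mat 1"
  using inverse matrix_left_right_inverse by blast

text \<open>Symmetry of \<open>G B\<close> means that \<open>B\<close> is self-adjoint for
  \<open>G\<close>: a factor \<open>B\<close> crosses \<open>G\<close> as its transpose. The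
  contractions of \<open>K\<close> with \<open>H\<close> below all rest on this.\<close>

lemma transpose_B_G: "transpose (B t) ** G t = K t"
  using sym[of t] by (simp add: K_def matrix_transpose_mul)

lemma K_H: "K t ** H t = transpose (B t)"
  by (simp add: transpose_B_G[symmetric] matrix_mul_assoc[symmetric] GH)

lemma K_B_H: "K t ** B t ** H t = transpose (B t ** B t)"
proof -
  have "K t ** B t ** H t = transpose (B t) ** (K t ** H t)"
    unfolding transpose_B_G[symmetric] by (simp add: K_def transpose_B_G matrix_mul_assoc)
  then show ?thesis by (simp add: K_H matrix_transpose_mul)
qed

lemma K_B_sym: "(K t ** B t) $ i $ j = (K t ** B t) $ j $ i"
proof -
  have "transpose (K t ** B t) = transpose (B t) ** transpose (K t)"
    by (simp add: matrix_transpose_mul)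
  also have "\<dots> = transpose (B t) ** G t ** B t"
    using sym(2)[of t] by (simp add: K_def matrix_mul_assoc)
  finally have "transpose (K t ** B t) = K t ** B t" by (simp add: transpose_B_G)
  then show ?thesis by (metis transpose_nth)
qed

text \<open>This contraction is the derivative of the logarithm of the volume density. The row term
  of \<open>B\<close> cancels against the contraction of \<open>H\<close> with \<open>K\<close>, and
  only the trace is left.\<close>

lemma sum_Chr: "(\<Sum>i\<in>UNIV. Chr i i p t) = - \<tau> * \<delta> p"
proof -
  have 1: "(\<Sum>i\<in>UNIV. H t $ i $ c * K t $ i $ p) = B t $ c $ p"
  proof -
    have "(\<Sum>i\<in>UNIV. H t $ i $ c * K t $ i $ p) = (K t ** H t) $ p $ c"
      by (simp add: matrix_matrix_mult_def mult.commute K_sym[of t p])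
    then show ?thesis by (simp add: K_H transpose_nth)
  qed
  have "(\<Sum>i\<in>UNIV. Chr i i p t) =
     (- (\<Sum>i\<in>UNIV. \<delta> i * B t $ i $ p) - \<delta> p * (\<Sum>i\<in>UNIV. B t $ i $ i) + (\<Sum>i\<in>UNIV. H t $ i $ c * K t $ i $ p)) / 2"
    unfolding Chr_def sum_distrib_left sum_subtractf[symmetric] sum.distrib[symmetric]
      sum_negf[symmetric] sum_divide_distrib
    by (rule sum.cong) (auto simp: algebra_simps)
  then show ?thesis using trace_B[of t] by (simp add: 1 trace_def)
qed

text \<open>The contracted symbols are constant in \<open>t\<close>, so the sum of the derivatives
  is zero by uniqueness of derivatives.\<close>

lemma sum_Chr': "(\<Sum>i\<in>UNIV. Chr' i i p t) = 0"
proof -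
  have "((\<lambda>t. \<Sum>i\<in>UNIV. Chr i i p t) has_real_derivative (\<Sum>i\<in>UNIV. Chr' i i p t)) (at t)"
    by (intro DERIV_sum Chr_has_derivative)
  then have "((\<lambda>t. - \<tau> * \<delta> p) has_real_derivative (\<Sum>i\<in>UNIV. Chr' i i p t)) (at t)"
    by (simp add: sum_Chr)
  then show ?thesis using DERIV_const DERIV_unique by blast
qed

text \<open>The product of two three-term symbols gives nine double sums, evaluated one by one; the
  factor 4 clears the two halves. The terms with a row of \<open>B t ** B t\<close> cancel in
  pairs.\<close>

lemma sum_Chr_Chr:
  "4 * (\<Sum>i\<in>UNIV. \<Sum>p\<in>UNIV. Chr i l p t * Chr p i j t) =
    \<delta> l * \<delta> j * trace (B t ** B t) + 2 * (B t $ c $ l * B t $ c $ j) - 2 * \<epsilon> * (K t ** B t) $ l $ j"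
proof -
  let ?S = "\<lambda>f. \<Sum>i\<in>UNIV. \<Sum>p\<in>UNIV. (f i p :: real)"
  have "4 * (Chr i l p t * Chr p i j t) =
      \<delta> l * (\<delta> i * (B t $ i $ p * B t $ p $ j)) + \<delta> l * \<delta> j * (B t $ i $ p * B t $ p $ i)
      - \<delta> l * (K t $ j $ i * (B t $ i $ p * H t $ p $ c))
      + (\<delta> i * B t $ p $ j) * (\<delta> p * B t $ i $ l) + \<delta> j * (\<delta> p * (B t $ p $ i * B t $ i $ l))
      - \<delta> p * (H t $ p $ c * (K t $ j $ i * B t $ i $ l))
      - \<delta> i * (H t $ i $ c * (K t $ l $ p * B t $ p $ j)) - \<delta> j * (K t $ l $ p * (B t $ p $ i * H t $ i $ c))
      + (K t $ l $ p * H t $ p $ c) * (K t $ j $ i * H t $ i $ c)" for i p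
    unfolding Chr_def K_sym[of t i j] by (simp add: field_simps)
  then have "4 * ?S (\<lambda>i p. Chr i l p t * Chr p i j t) =
      \<delta> l * ?S (\<lambda>i p. \<delta> i * (B t $ i $ p * B t $ p $ j)) + \<delta> l * \<delta> j * ?S (\<lambda>i p. B t $ i $ p * B t $ p $ i)
      - \<delta> l * ?S (\<lambda>i p. K t $ j $ i * (B t $ i $ p * H t $ p $ c))
      + ?S (\<lambda>i p. (\<delta> i * B t $ p $ j) * (\<delta> p * B t $ i $ l))
      + \<delta> j * ?S (\<lambda>i p. \<delta> p * (B t $ p $ i * B t $ i $ l))
      - ?S (\<lambda>i p. \<delta> p * (H t $ p $ c * (K t $ j $ i * B t $ i $ l)))
      - ?S (\<lambda>i p. \<delta> i * (H t $ i $ c * (K t $ l $ p * B t $ p $ j)))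
      - \<delta> j * ?S (\<lambda>i p. K t $ l $ p * (B t $ p $ i * H t $ i $ c))
      + ?S (\<lambda>i p. (K t $ l $ p * H t $ p $ c) * (K t $ j $ i * H t $ i $ c))"
    unfolding sum_distrib_left by (simp add: sum_subtractf sum.distrib)
  moreover have "?S (\<lambda>i p. \<delta> i * (B t $ i $ p * B t $ p $ j)) = (B t ** B t) $ c $ j"
    by (simp add: sum_distrib_left[symmetric] matrix_matrix_mult_def)
  moreover have "?S (\<lambda>i p. B t $ i $ p * B t $ p $ i) = trace (B t ** B t)"
    by (simp add: trace_def matrix_matrix_mult_def)
  moreover have KBH: "(\<Sum>i\<in>UNIV. \<Sum>p\<in>UNIV. K t $ j $ i * (B t $ i $ p * H t $ p $ c)) = (B t ** B t) $ c $ j" for j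
  proof -
    have "(\<Sum>i\<in>UNIV. \<Sum>p\<in>UNIV. K t $ j $ i * (B t $ i $ p * H t $ p $ c)) = (K t ** (B t ** H t)) $ j $ c"
      by (simp add: matrix_matrix_mult_def sum_distrib_left)
    then show ?thesis by (simp add: matrix_mul_assoc K_B_H transpose_nth)
  qed
  moreover have "?S (\<lambda>i p. (\<delta> i * B t $ p $ j) * (\<delta> p * B t $ i $ l)) = B t $ c $ j * B t $ c $ l"
  proof -
    have "?S (\<lambda>i p. (\<delta> i * B t $ p $ j) * (\<delta> p * B t $ i $ l)) =
        ?S (\<lambda>i p. \<delta> i * (\<delta> p * (B t $ p $ j * B t $ i $ l)))"
      by (intro sum.cong refl) (simp add: mult_ac)
    then show ?thesis by (simp add: sum_distrib_left[symmetric])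
  qed
  moreover have "?S (\<lambda>i p. \<delta> p * (B t $ p $ i * B t $ i $ l)) = (B t ** B t) $ c $ l"
    by (simp add: matrix_matrix_mult_def)
  moreover have "?S (\<lambda>i p. \<delta> p * (H t $ p $ c * (K t $ j $ i * B t $ i $ l))) = \<epsilon> * (K t ** B t) $ l $ j"
    by (subst K_B_sym) (simp add: matrix_matrix_mult_def corner sum_distrib_left)
  moreover have "?S (\<lambda>i p. \<delta> i * (H t $ i $ c * (K t $ l $ p * B t $ p $ j))) = \<epsilon> * (K t ** B t) $ l $ j"
    by (simp add: sum_distrib_left[symmetric] matrix_matrix_mult_def corner)
  moreover have "?S (\<lambda>i p. K t $ l $ p * (B t $ p $ i * H t $ i $ c)) = (B t ** B t) $ c $ l"
    using KBH[of l] by (subst sum.swap) simp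
  moreover have "?S (\<lambda>i p. (K t $ l $ p * H t $ p $ c) * (K t $ j $ i * H t $ i $ c)) = B t $ c $ l * B t $ c $ j"
  proof -
    have "(\<Sum>p\<in>UNIV. K t $ l $ p * H t $ p $ c) = B t $ c $ l" for l
      using K_H[of t] by (simp add: vec_eq_iff matrix_matrix_mult_def transpose_def)
    then show ?thesis by (simp add: sum_distrib_right[symmetric] sum_distrib_left[symmetric])
  qed
  ultimately show ?thesis by (simp add: algebra_simps)
qed

text \<open>In the coordinate formula the derivative terms reduce to \<open>Chr'\<close> with upper
  index \<open>c\<close>, the contracted symbols contribute \<open>- \<tau>\<close> times
  \<open>Chr\<close>, and the remaining quadratic term is \<open>sum_Chr_Chr\<close>.\<close>

lemma ricci_metric:
  assumes "t = x $ c"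
  shows "2 * ricci metric x $ j $ l =
    \<delta> l * ((B t ** N) $ c $ j + \<tau> * B t $ c $ j) + \<delta> j * ((B t ** N) $ c $ l + \<tau> * B t $ c $ l)
    + \<epsilon> * (G t ** (N ** B t - B t ** N) - \<tau> *\<^sub>R K t) $ l $ j
    - \<delta> l * \<delta> j * trace (B t ** B t) / 2 - B t $ c $ l * B t $ c $ j"
proof -
  have NB: "(N ** B t) $ c $ j = 0" for j
    by (simp add: matrix_matrix_mult_def row_N)
  \<comment> \<open>This entry is the derivative of the constant corner entry of
    \<open>H\<close>.\<close>
  have BH: "(B t ** H t) $ c $ c = 0"
  proof -
    have "((\<lambda>t. H t $ c $ c) has_real_derivative (B t ** H t) $ c $ c) (at t)"
      using deriv_H[of t] unfolding has_vector_derivative_matrix_iff by blast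
    then show ?thesis unfolding corner using DERIV_const DERIV_unique by blast
  qed
  have "ricci metric x $ j $ l = (\<Sum>i\<in>UNIV. \<delta> i * Chr' i l j t - \<delta> l * Chr' i i j t
      + (\<Sum>p\<in>UNIV. Chr i i p t * Chr p l j t - Chr i l p t * Chr p i j t))"
    by (simp add: ricci_def riemann_def partial_christoffel_metric christoffel_metric assms)
  also have "\<dots> = Chr' c l j t - \<delta> l * (\<Sum>i\<in>UNIV. Chr' i i j t)
      + (\<Sum>i\<in>UNIV. \<Sum>p\<in>UNIV. Chr i i p t * Chr p l j t) - (\<Sum>i\<in>UNIV. \<Sum>p\<in>UNIV. Chr i l p t * Chr p i j t)"
    by (simp add: sum.distrib sum_subtractf sum_distrib_left[symmetric])
  also have "(\<Sum>i\<in>UNIV. \<Sum>p\<in>UNIV. Chr i i p t * Chr p l j t) = - \<tau> * Chr c l j t"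
  proof -
    have "(\<Sum>i\<in>UNIV. \<Sum>p\<in>UNIV. Chr i i p t * Chr p l j t) = (\<Sum>p\<in>UNIV. (\<Sum>i\<in>UNIV. Chr i i p t) * Chr p l j t)"
      by (subst sum.swap) (simp add: sum_distrib_right)
    also have "\<dots> = (\<Sum>p\<in>UNIV. - (\<delta> p * (\<tau> * Chr p l j t)))"
      by (simp add: sum_Chr mult_ac)
    finally have "(\<Sum>i\<in>UNIV. \<Sum>p\<in>UNIV. Chr i i p t * Chr p l j t) =
        (\<Sum>p\<in>UNIV. - (\<delta> p * (\<tau> * Chr p l j t)))" .
    then show ?thesis by (simp add: sum_negf)
  qed
  finally have "2 * ricci metric x $ j $ l = 2 * Chr' c l j t - 2 * \<tau> * Chr c l j t
      - (4 * (\<Sum>i\<in>UNIV. \<Sum>p\<in>UNIV. Chr i l p t * Chr p i j t)) / 2"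
    by (simp add: sum_Chr')
  then show ?thesis
    unfolding sum_Chr_Chr
    by (simp add: Chr_def Chr'_def NB BH corner algebra_simps diff_divide_distrib add_divide_distrib)
qed

end

section \<open>Naturality of the Ricci tensor\<close>

lemma has_derivative_partial:
  assumes "f differentiable (at x)"
  shows "(f has_derivative (\<lambda>v. \<Sum>i\<in>UNIV. v $ i * partial i f x)) (at x)"
proof -
  have d: "(f has_derivative frechet_derivative f (at x)) (at x)"
    using assms by (simp add: frechet_derivative_works)
  then interpret bounded_linear "frechet_derivative f (at x)" by (rule has_derivative_bounded_linear)
  have "frechet_derivative f (at x) v = (\<Sum>i\<in>UNIV. v $ i * partial i f x)" for v
  proof -
    have "frechet_derivative f (at x) v = frechet_derivative f (at x) (\<Sum>i\<in>UNIV. v $ i *\<^sub>R axis i 1)"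
      by (simp add: basis_expansion flip: scalar_mult_eq_scaleR)
    then show ?thesis by (simp add: sum scaleR partial_def)
  qed
  then have "frechet_derivative f (at x) = (\<lambda>v. \<Sum>i\<in>UNIV. v $ i * partial i f x)" by blast
  then show ?thesis using d by simp
qed

lemma partial_eqI: "(f has_derivative f') (at x) \<Longrightarrow> partial i f x = f' (axis i 1)"
  unfolding partial_def using frechet_derivative_at by metis

lemma partial_add:
  assumes "f differentiable (at x)" "g differentiable (at x)"
  shows "partial i (\<lambda>y. f y + g y) x = partial i f x + partial i g x"
  by (subst partial_eqI[OF has_derivative_add[OF assms[unfolded frechet_derivative_works]]])
     (simp add: partial_def)

lemma partial_mult:
  assumes "f differentiable (at x)" "g differentiable (at x)"
  shows "partial i (\<lambda>y. f y * g y) x = partial i f x * g x + f x * partial i g x"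
  by (subst partial_eqI[OF has_derivative_mult[OF assms[unfolded frechet_derivative_works]]])
     (simp add: partial_def)

lemma partial_sum:
  assumes "\<And>a. a \<in> I \<Longrightarrow> f a differentiable (at x)"
  shows "partial i (\<lambda>y. \<Sum>a\<in>I. f a y) x = (\<Sum>a\<in>I. partial i (f a) x)"
  by (subst partial_eqI[OF has_derivative_sum[OF assms[unfolded frechet_derivative_works]]])
     (simp_all add: partial_def)

lemma differentiable_vec:
  assumes "\<And>i. (\<lambda>y. \<phi> y $ i) differentiable (at x)"
  shows "(\<phi> :: real^'n \<Rightarrow> real^'m) differentiable (at x)"
proof (subst differentiable_componentwise_within, safe)
  fix b :: "real^'m" assume "b \<in> Basis"
  then obtain i where "b = axis i 1" by (auto simp: Basis_vec_def)
  then show "(\<lambda>y. \<phi> y \<bullet> b) differentiable (at x)" using assms by (simp add: inner_axis)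
qed

lemma differentiable_compose_at:
  assumes "f differentiable (at (\<phi> x))" "\<phi> differentiable (at x)"
  shows "(\<lambda>y. f (\<phi> y)) differentiable (at x)"
  using differentiable_chain_at[OF assms(2,1)] by (simp add: o_def)

lemma partial_nth:
  assumes "\<phi> differentiable (at x)"
  shows "partial i (\<lambda>y. \<phi> y $ a) x = frechet_derivative \<phi> (at x) (axis i 1) $ a"
  by (rule partial_eqI)
     (use assms in \<open>auto simp: frechet_derivative_works intro: bounded_linear.has_derivative[OF bounded_linear_vec_nth]\<close>)

lemma partial_compose:
  assumes "f differentiable (at (\<phi> x))" "\<phi> differentiable (at x)"
  shows "partial i (\<lambda>y. f (\<phi> y)) x = (\<Sum>a\<in>UNIV. partial i (\<lambda>y. \<phi> y $ a) x * partial a f (\<phi> x))"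
  using partial_eqI[OF has_derivative_compose[OF assms(2)[unfolded frechet_derivative_works]
      has_derivative_partial[OF assms(1)]]]
  by (simp add: partial_nth[OF assms(2)])

section \<open>Equality of mixed second partial derivatives\<close>

lemma partial_along_line:
  assumes "\<And>x. f differentiable (at x)"
  shows "((\<lambda>s. f (p + s *\<^sub>R axis i 1)) has_real_derivative partial i f (p + s *\<^sub>R axis i 1)) (at s)"
proof -
  have "((\<lambda>s. p + s *\<^sub>R axis i 1) has_derivative (\<lambda>s. s *\<^sub>R axis i 1)) (at s)"
    by (auto intro!: derivative_eq_intros)
  from has_derivative_compose[OF this assms[of "p + s *\<^sub>R axis i 1", unfolded frechet_derivative_works]]
  have *: "((\<lambda>s. f (p + s *\<^sub>R axis i 1)) has_derivative
      (\<lambda>s'. frechet_derivative f (at (p + s *\<^sub>R axis i 1)) (s' *\<^sub>R axis i 1))) (at s)" .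
  have "linear (frechet_derivative f (at (p + s *\<^sub>R axis i 1)))"
    using assms by (rule linear_frechet_derivative)
  then have "frechet_derivative f (at (p + s *\<^sub>R axis i 1)) (s' *\<^sub>R axis i 1) =
      partial i f (p + s *\<^sub>R axis i 1) * s'" for s'
    by (simp add: linear_cmul partial_def mult.commute)
  with * show ?thesis by (simp add: has_field_derivative_def)
qed

text \<open>The mean value theorem is applied twice: in direction \<open>i\<close> to the increment
  of \<open>f\<close> across a step in direction \<open>j\<close>, then in direction
  \<open>j\<close> to \<open>partial i f\<close>.\<close>

lemma second_difference_mean_value:
  assumes f: "\<And>x. f differentiable (at x)" and fi: "\<And>x. partial i f differentiable (at x)" and h: "h > 0"
  shows "\<exists>p q. 0 < p \<and> p < h \<and> 0 < q \<and> q < h \<and>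
    f (x + h *\<^sub>R axis i 1 + h *\<^sub>R axis j 1) - f (x + h *\<^sub>R axis i 1) - f (x + h *\<^sub>R axis j 1) + f x =
    h * h * partial j (partial i f) (x + p *\<^sub>R axis i 1 + q *\<^sub>R axis j 1)"
proof -
  define u v :: "real^'a" where "u = axis i 1" "v = axis j 1"
  define F where "F s = f (x + h *\<^sub>R v + s *\<^sub>R u) - f (x + s *\<^sub>R u)" for s
  define F' where "F' s = partial i f (x + h *\<^sub>R v + s *\<^sub>R u) - partial i f (x + s *\<^sub>R u)" for s
  have "(F has_real_derivative F' s) (at s)" for s
    unfolding F_def[abs_def] F'_def u_v_def by (intro DERIV_diff partial_along_line f)
  then obtain p where p: "0 < p" "p < h" "F h - F 0 = h * F' p"
    using MVT2[OF h, of F F'] by auto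
  define E where "E r = partial i f (x + p *\<^sub>R u + r *\<^sub>R v)" for r
  define E' where "E' r = partial j (partial i f) (x + p *\<^sub>R u + r *\<^sub>R v)" for r
  have "(E has_real_derivative E' r) (at r)" for r
    unfolding E_def[abs_def] E'_def u_v_def by (intro partial_along_line fi)
  then obtain q where q: "0 < q" "q < h" "E h - E 0 = h * E' q"
    using MVT2[OF h, of E E'] by auto
  have "F' p = E h - E 0" by (simp add: F'_def E_def add_ac)
  then have "F h - F 0 = h * (h * E' q)" by (simp only: p(3) q(3))
  then have "f (x + h *\<^sub>R v + h *\<^sub>R u) - f (x + h *\<^sub>R u) - (f (x + h *\<^sub>R v) - f x) =
      h * (h * partial j (partial i f) (x + p *\<^sub>R u + q *\<^sub>R v))"
    by (simp add: F_def E'_def)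
  moreover have "x + h *\<^sub>R v + h *\<^sub>R u = x + h *\<^sub>R u + h *\<^sub>R v" by simp
  ultimately have "f (x + h *\<^sub>R u + h *\<^sub>R v) - f (x + h *\<^sub>R u) - f (x + h *\<^sub>R v) + f x =
      h * h * partial j (partial i f) (x + p *\<^sub>R u + q *\<^sub>R v)"
    by (simp add: mult.assoc)
  then show ?thesis using p(1,2) q(1,2) unfolding u_v_def by blast
qed

text \<open>The second difference is symmetric in the two directions, so values of the two mixed
  partials agree at suitable points near \<open>x\<close>. If they differed at \<open>x\<close>,
  continuity would keep them apart.\<close>

lemma partial_commute:
  assumes "C_k 2 f"
  shows "partial i (partial j f) x = partial j (partial i f) x"
proof (rule ccontr)
  have C: "f differentiable (at x)" "partial i f differentiable (at x)"
    "continuous_on UNIV (partial i (partial j f))" for i j x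
    using assms by (auto simp: numeral_2_eq_2)
  define a b where "a = partial i (partial j f)" "b = partial j (partial i f)"
  assume "\<not> ?thesis"
  then have e: "\<bar>a x - b x\<bar> / 2 > 0" by (simp add: a_b_def)
  have "isCont a x" "isCont b x"
    using C(3) by (auto simp: a_b_def continuous_on_eq_continuous_at)
  then obtain r s where r: "r > 0" "\<And>y. dist y x < r \<Longrightarrow> dist (a y) (a x) < \<bar>a x - b x\<bar> / 2"
    and s: "s > 0" "\<And>y. dist y x < s \<Longrightarrow> dist (b y) (b x) < \<bar>a x - b x\<bar> / 2"
    using e unfolding continuous_at_eps_delta by blast
  \<comment> \<open>The mean value points lie within \<open>p + q\<close> of \<open>x\<close>, which
    is less than twice \<open>h\<close>.\<close>
  define h where "h = min r s / 2"
  have h: "h > 0" using r s by (simp add: h_def)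
  have near: "dist (x + p *\<^sub>R axis k 1 + q *\<^sub>R axis l 1) x < min r s"
    if "0 < p" "p < h" "0 < q" "q < h" for p q k l
  proof -
    have "norm (p *\<^sub>R axis k (1::real) + q *\<^sub>R axis l 1) \<le> p + q"
      using norm_triangle_ineq[of "p *\<^sub>R axis k (1::real)" "q *\<^sub>R axis l 1"] that by (simp add: norm_axis_1)
    also have "\<dots> < min r s" using that unfolding h_def by linarith
    finally show ?thesis by (simp add: dist_norm add.assoc)
  qed
  obtain p q where 1: "0 < p" "p < h" "0 < q" "q < h"
    "f (x + h *\<^sub>R axis i 1 + h *\<^sub>R axis j 1) - f (x + h *\<^sub>R axis i 1) - f (x + h *\<^sub>R axis j 1) + f x =
    h * h * b (x + p *\<^sub>R axis i 1 + q *\<^sub>R axis j 1)"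
    unfolding a_b_def using second_difference_mean_value[OF C(1) C(2) h, of x i j] by blast
  obtain p' q' where 2: "0 < p'" "p' < h" "0 < q'" "q' < h"
    "f (x + h *\<^sub>R axis j 1 + h *\<^sub>R axis i 1) - f (x + h *\<^sub>R axis j 1) - f (x + h *\<^sub>R axis i 1) + f x =
    h * h * a (x + p' *\<^sub>R axis j 1 + q' *\<^sub>R axis i 1)"
    unfolding a_b_def using second_difference_mean_value[OF C(1) C(2) h, of x j i] by blast
  have "h * h * a (x + p' *\<^sub>R axis j 1 + q' *\<^sub>R axis i 1) = h * h * b (x + p *\<^sub>R axis i 1 + q *\<^sub>R axis j 1)"
    unfolding 1(5)[symmetric] 2(5)[symmetric]
    by (simp add: add.assoc add.commute[of "h *\<^sub>R axis i 1"])
  then have "a (x + p' *\<^sub>R axis j 1 + q' *\<^sub>R axis i 1) = b (x + p *\<^sub>R axis i 1 + q *\<^sub>R axis j 1)"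
    using h by simp
  moreover have "dist (a (x + p' *\<^sub>R axis j 1 + q' *\<^sub>R axis i 1)) (a x) < \<bar>a x - b x\<bar> / 2"
    by (rule r(2)) (use near[OF 2(1-4)] in auto)
  moreover have "dist (b (x + p *\<^sub>R axis i 1 + q *\<^sub>R axis j 1)) (b x) < \<bar>a x - b x\<bar> / 2"
    by (rule s(2)) (use near[OF 1(1-4)] in auto)
  ultimately have "dist (a x) (b x) < \<bar>a x - b x\<bar>"
    using dist_triangle_half_r[of "b (x + p *\<^sub>R axis i 1 + q *\<^sub>R axis j 1)" "a x" "\<bar>a x - b x\<bar>" "b x"] by simp
  then show False by (simp add: dist_real_def)
qed

section \<open>Connection and curvature in matrix form\<close>

definition differentiable_entries :: "(real^'n \<Rightarrow> real^'p^'m) \<Rightarrow> bool" where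
  "differentiable_entries M \<longleftrightarrow> (\<forall>a b x. (\<lambda>y. M y $ a $ b) differentiable (at x))"

definition partial_matrix :: "'n::finite \<Rightarrow> (real^'n \<Rightarrow> real^'p^'m) \<Rightarrow> real^'n \<Rightarrow> real^'p^'m" where
  "partial_matrix k M x = (\<chi> a b. partial k (\<lambda>y. M y $ a $ b) x)"

text \<open>The matrix of the covariant derivative along the \<open>k\<close>-th coordinate field,
  in the coordinate frame.\<close>

definition connection :: "(real^'n::finite \<Rightarrow> real^'n^'n) \<Rightarrow> 'n \<Rightarrow> real^'n \<Rightarrow> real^'n^'n" where
  "connection g k x = (\<chi> i j. christoffel g i k j x)"

text \<open>The matrix of the curvature operator of the coordinate fields \<open>k\<close> and
  \<open>l\<close>; in this form its change of frame is a computation with matrix products.\<close>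

definition curvature :: "(real^'n::finite \<Rightarrow> real^'n^'n) \<Rightarrow> 'n \<Rightarrow> 'n \<Rightarrow> real^'n \<Rightarrow> real^'n^'n" where
  "curvature g k l x = partial_matrix k (connection g l) x - partial_matrix l (connection g k) x
     + (connection g k x ** connection g l x - connection g l x ** connection g k x)"

lemma riemann_eq_curvature: "riemann g i j k l x = curvature g k l x $ i $ j"
  by (simp add: riemann_def curvature_def partial_matrix_def connection_def matrix_matrix_mult_def
      sum_subtractf)

lemma differentiable_entries_mult:
  assumes "differentiable_entries M" "differentiable_entries N"
  shows "differentiable_entries (\<lambda>x. M x ** N x)"
  using assms unfolding differentiable_entries_def matrix_matrix_mult_def
  by (auto intro!: differentiable_sum differentiable_mult)

lemma differentiable_entries_add:
  assumes "differentiable_entries M" "differentiable_entries N"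
  shows "differentiable_entries (\<lambda>x. M x + N x)"
  using assms unfolding differentiable_entries_def by (auto intro!: differentiable_add)

lemma partial_matrix_mult:
  assumes "differentiable_entries M" "differentiable_entries N"
  shows "partial_matrix k (\<lambda>x. M x ** N x) x = partial_matrix k M x ** N x + M x ** partial_matrix k N x"
  using assms
  by (simp add: vec_eq_iff partial_matrix_def matrix_matrix_mult_def differentiable_entries_def
      partial_sum partial_mult differentiable_mult sum.distrib)

lemma partial_matrix_add:
  assumes "differentiable_entries M" "differentiable_entries N"
  shows "partial_matrix k (\<lambda>x. M x + N x) x = partial_matrix k M x + partial_matrix k N x"
  using assms by (simp add: vec_eq_iff partial_matrix_def differentiable_entries_def partial_add)

lemma partial_matrix_transpose:
  "partial_matrix k (\<lambda>x. transpose (M x)) x = transpose (partial_matrix k M x)"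
  by (simp add: vec_eq_iff partial_matrix_def transpose_def)

text \<open>The Koszul argument at a single point: after lowering an index of \<open>W\<close>, the
  alternating sum of metric derivatives collapses to twice one term. It later identifies the
  connection of a pulled-back metric.\<close>

lemma connection_unique:
  assumes inv: "H ** g x = mat 1" and sym: "transpose (g x) = g x"
    and torsion_free: "\<And>i j k. W k $ i $ j = W j $ i $ k"
    and compatible: "\<And>k. partial_matrix k g x = g x ** W k + transpose (W k) ** g x"
  shows "connection g k x = W k"
proof -
  define L where "L k = g x ** W k" for k
  have L_sym: "L k $ l $ j = L j $ l $ k" for k l j
    unfolding L_def matrix_matrix_mult_def using torsion_free by simp
  have "transpose (W k) ** g x = transpose (L k)" for k
    by (simp add: L_def matrix_transpose_mul sym)
  then have D: "partial k (\<lambda>y. g y $ l $ j) x = L k $ l $ j + L k $ j $ l" for k l j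
    using arg_cong[OF compatible[of k], of "\<lambda>M. M $ l $ j"]
    by (simp add: partial_matrix_def L_def[symmetric] transpose_nth)
  have "christoffel g i k j x = (H ** L k) $ i $ j" for i k j
  proof -
    have "L k $ l $ j + L k $ j $ l + (L j $ l $ k + L j $ k $ l) - (L l $ k $ j + L l $ j $ k) = 2 * L k $ l $ j" for l
      using L_sym[of j l k] L_sym[of k j l] L_sym[of j k l] by linarith
    then have "christoffel g i k j x = (\<Sum>l\<in>UNIV. H $ i $ l * (2 * L k $ l $ j)) / 2"
      by (simp only: christoffel_def matrix_inv_eqI[OF inv] D)
    then show ?thesis by (simp add: matrix_matrix_mult_def sum_divide_distrib)
  qed
  then show ?thesis by (simp add: vec_eq_iff connection_def L_def matrix_mul_assoc inv)
qed

lemma partial_metric_sym: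
  assumes "\<And>x. transpose (g x) = g x"
  shows "partial k (\<lambda>y. g y $ i $ j) x = partial k (\<lambda>y. g y $ j $ i) x"
  using assms by (metis transpose_nth)

lemma connection_torsion_free:
  assumes "\<And>x. transpose (g x) = g x"
  shows "connection g k x $ i $ j = connection g j x $ i $ k"
proof -
  have "partial l (\<lambda>y. g y $ k $ j) x = partial l (\<lambda>y. g y $ j $ k) x" for l
    by (rule partial_metric_sym[OF assms])
  then show ?thesis
    unfolding connection_def christoffel_def
    by (simp only: vec_lambda_beta add.commute[of "partial k _ x"])
qed

text \<open>Lowering the index leaves the Christoffel symbols of the first kind, here
  \<open>L\<close>; in \<open>L + transpose L\<close> all derivatives cancel except the one in
  direction \<open>k\<close>.\<close>

lemma connection_compatible:
  assumes inv: "H ** g x = mat 1" and sym: "\<And>x. transpose (g x) = g x"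
  shows "partial_matrix k g x = g x ** connection g k x + transpose (connection g k x) ** g x"
proof -
  define D where "D k i j = partial k (\<lambda>y. g y $ i $ j) x" for k i j
  define L where "L = (\<chi> l j. (D k l j + D j l k - D l k j) / 2)"
  have D_sym: "D k i j = D k j i" for k i j
    unfolding D_def by (rule partial_metric_sym[OF sym])
  have "connection g k x = H ** L"
    by (simp add: vec_eq_iff connection_def christoffel_def matrix_inv_eqI[OF inv] L_def
        matrix_matrix_mult_def sum_divide_distrib D_def)
  moreover have "g x ** H = mat 1" using inv matrix_left_right_inverse by blast
  ultimately have L: "g x ** connection g k x = L" by (simp add: matrix_mul_assoc)
  have T: "transpose (connection g k x) ** g x = transpose (g x ** connection g k x)"
    by (simp add: matrix_transpose_mul sym)
  have "partial_matrix k g x $ i $ j = (L + transpose L) $ i $ j" for i j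
    using D_sym[of k i j] D_sym[of j i k] D_sym[of i j k]
    by (simp add: partial_matrix_def D_def[symmetric] L_def transpose_nth field_simps)
  then have "partial_matrix k g x = L + transpose L" by (simp add: vec_eq_iff)
  then show ?thesis by (simp add: L T)
qed

lemma sum_matrix_mult:
  fixes A :: "'i \<Rightarrow> real^'n^'m"
  shows "(\<Sum>i\<in>I. A i) ** B = (\<Sum>i\<in>I. A i ** B)" "C ** (\<Sum>i\<in>I. A i) = (\<Sum>i\<in>I. C ** A i)"
  by (simp_all add: bounded_bilinear.sum_left[OF bounded_bilinear_matrix_mult]
      bounded_bilinear.sum_right[OF bounded_bilinear_matrix_mult])

lemma transpose_sum: "transpose (\<Sum>i\<in>I. A i) = (\<Sum>i\<in>I. transpose (A i :: real^'n^'m))"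
  by (simp add: vec_eq_iff transpose_nth)

section \<open>Transformation of connection and curvature under a diffeomorphism\<close>

locale metric_pullback =
  fixes \<phi> :: "real^'n \<Rightarrow> real^'n" and h H :: "real^'n::finite \<Rightarrow> real^'n^'n"
  assumes diffeo: "diffeomorphism \<phi>"
    and sym: "\<And>y. transpose (h y) = h y"
    and inverse: "\<And>y. H y ** h y = mat 1"
    and diff_h: "differentiable_entries h"
    and diff_connection: "\<And>k. differentiable_entries (connection h k)"
begin

definition g :: "real^'n \<Rightarrow> real^'n^'n" where "g = pullback \<phi> h"

definition J :: "real^'n \<Rightarrow> real^'n^'n" where "J x = jacobian \<phi> (at x)"

definition Q :: "real^'n \<Rightarrow> real^'n^'n" where "Q x = jacobian (inv \<phi>) (at (\<phi> x))"

text \<open>Component \<open>k\<close> of the connection form of \<open>h\<close> pulled back along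
  \<open>\<phi>\<close>, still written in the coordinate frame of the target.\<close>

definition Om :: "'n \<Rightarrow> real^'n \<Rightarrow> real^'n^'n" where
  "Om k x = (\<Sum>b\<in>UNIV. J x $ b $ k *\<^sub>R connection h b (\<phi> x))"

lemma C_k_components: "C_k k (\<lambda>x. \<phi> x $ i)" "C_k k (\<lambda>x. inv \<phi> x $ i)"
  using diffeo by (auto simp: diffeomorphism_def smooth_map_def)

lemma differentiable_components:
  "(\<lambda>x. \<phi> x $ i) differentiable (at x)" "(\<lambda>x. inv \<phi> x $ i) differentiable (at x)"
  "partial j (\<lambda>x. \<phi> x $ i) differentiable (at x)" "partial j (\<lambda>x. inv \<phi> x $ i) differentiable (at x)"
  "partial k (partial j (\<lambda>x. \<phi> x $ i)) differentiable (at x)"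
  \<comment> \<open>Class three makes the second partials of \<open>\<phi>\<close>, which are the
    entries of the derivatives of \<open>J\<close>, differentiable.\<close>
  using C_k_components(1)[of "Suc (Suc (Suc 0))" i] C_k_components(2)[of "Suc (Suc (Suc 0))" i] by auto

lemma differentiable_\<phi>: "\<phi> differentiable (at x)" "inv \<phi> differentiable (at x)"
  by (intro differentiable_vec differentiable_components)+

lemma J_nth: "J x $ a $ i = partial i (\<lambda>y. \<phi> y $ a) x"
  by (simp add: J_def jacobian_def matrix_def partial_nth differentiable_\<phi>)

lemma Q_nth: "Q x $ a $ i = partial i (\<lambda>y. inv \<phi> y $ a) (\<phi> x)"
  by (simp add: Q_def jacobian_def matrix_def partial_nth differentiable_\<phi>)

lemma partial_J_nth: "partial_matrix k J x $ a $ i = partial k (partial i (\<lambda>y. \<phi> y $ a)) x"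
  by (simp add: partial_matrix_def J_nth)

lemma partial_J_sym: "partial_matrix k J x $ a $ i = partial_matrix i J x $ a $ k"
  unfolding partial_J_nth by (rule partial_commute[OF C_k_components(1)])

lemma partial_partial_J_sym: "partial_matrix k (partial_matrix l J) x = partial_matrix l (partial_matrix k J) x"
proof -
  have "C_k (Suc 2) (\<lambda>y. \<phi> y $ a)" for a by (rule C_k_components)
  then have "C_k 2 (partial i (\<lambda>y. \<phi> y $ a))" for a i by (metis C_k.simps(2))
  then have "partial k (partial l (partial i (\<lambda>y. \<phi> y $ a))) x =
      partial l (partial k (partial i (\<lambda>y. \<phi> y $ a))) x" for a i
    by (rule partial_commute)
  then have "partial_matrix k (partial_matrix l J) x $ a $ i = partial_matrix l (partial_matrix k J) x $ a $ i" for a i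
    by (simp only: partial_matrix_def[of _ "partial_matrix _ J"] partial_J_nth vec_lambda_beta)
  then show ?thesis by (simp add: vec_eq_iff)
qed

lemma differentiable_J:
  "differentiable_entries J" "differentiable_entries (partial_matrix k J)" "differentiable_entries Q"
  by (simp_all add: differentiable_entries_def J_nth partial_J_nth Q_nth differentiable_components
      differentiable_compose_at differentiable_\<phi>)

text \<open>The chain rule applied to \<open>inv \<phi> (\<phi> y) = y\<close>.\<close>

lemma Q_J: "Q x ** J x = mat 1"
proof -
  have "partial j (\<lambda>y. y $ i) x = (if i = j then 1 else 0)" for i j and x :: "real^'n"
    by (subst partial_eqI[OF bounded_linear_imp_has_derivative[OF bounded_linear_vec_nth]]) (simp add: axis_def)
  moreover have "(Q x ** J x) $ i $ j = partial j (\<lambda>y. inv \<phi> (\<phi> y) $ i) x" for i j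
    by (subst partial_compose[of "\<lambda>y. inv \<phi> y $ i"])
       (simp_all add: differentiable_components differentiable_\<phi> matrix_matrix_mult_def J_nth Q_nth mult.commute)
  moreover have "inv \<phi> (\<phi> y) = y" for y
    using diffeo by (simp add: diffeomorphism_def bij_def)
  ultimately show ?thesis by (simp add: vec_eq_iff mat_def)
qed

lemma J_Q: "J x ** Q x = mat 1"
  using Q_J matrix_left_right_inverse by blast

lemma partial_matrix_compose:
  assumes "differentiable_entries M"
  shows "partial_matrix l (\<lambda>x. M (\<phi> x)) x = (\<Sum>c\<in>UNIV. J x $ c $ l *\<^sub>R partial_matrix c M (\<phi> x))"
  using assms unfolding differentiable_entries_def
  by (simp add: vec_eq_iff partial_matrix_def J_nth partial_compose[where f = "\<lambda>y. M y $ _ $ _"] differentiable_\<phi>)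

lemma differentiable_entries_compose:
  assumes "differentiable_entries M"
  shows "differentiable_entries (\<lambda>x. M (\<phi> x))"
  unfolding differentiable_entries_def
proof (intro allI)
  fix a b x
  show "(\<lambda>y. M (\<phi> y) $ a $ b) differentiable (at x)"
    using assms differentiable_compose_at[of "\<lambda>y. M y $ a $ b" \<phi> x] differentiable_\<phi>(1)
    unfolding differentiable_entries_def by blast
qed

lemma differentiable_Om: "differentiable_entries (Om k)"
  using differentiable_J(1) differentiable_entries_compose[OF diff_connection]
  unfolding differentiable_entries_def Om_def
  by (auto intro!: differentiable_sum differentiable_mult)

lemma partial_Om:
  "partial_matrix k (Om l) x = (\<Sum>b\<in>UNIV. partial_matrix k J x $ b $ l *\<^sub>R connection h b (\<phi> x)
     + J x $ b $ l *\<^sub>R (\<Sum>c\<in>UNIV. J x $ c $ k *\<^sub>R partial_matrix c (connection h b) (\<phi> x)))"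
proof -
  have "partial_matrix k (Om l) x $ i $ j =
      (\<Sum>b\<in>UNIV. partial k (\<lambda>y. J y $ b $ l * connection h b (\<phi> y) $ i $ j) x)" for i j
    using differentiable_J(1) differentiable_entries_compose[OF diff_connection]
    unfolding differentiable_entries_def
    by (simp add: partial_matrix_def Om_def partial_sum differentiable_mult)
  also have "\<dots> i j = (\<Sum>b\<in>UNIV. partial_matrix k J x $ b $ l * connection h b (\<phi> x) $ i $ j
     + J x $ b $ l * partial_matrix k (\<lambda>x. connection h b (\<phi> x)) x $ i $ j)" for i j
    using differentiable_J(1) differentiable_entries_compose[OF diff_connection]
    unfolding differentiable_entries_def
    by (simp add: partial_mult partial_matrix_def)
  finally show ?thesis
    by (simp add: vec_eq_iff partial_matrix_compose[OF diff_connection])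
qed

lemma g_eq: "g x = transpose (J x) ** h (\<phi> x) ** J x"
  by (simp add: g_def pullback_def J_def)

lemma g_sym: "transpose (g x) = g x"
  by (simp add: g_eq matrix_transpose_mul sym matrix_mul_assoc)

lemma g_inverse: "(Q x ** H (\<phi> x) ** transpose (Q x)) ** g x = mat 1"
proof -
  have "transpose (Q x) ** transpose (J x) = mat 1"
    by (simp add: matrix_transpose_mul[symmetric] J_Q)
  then have "(Q x ** H (\<phi> x) ** transpose (Q x)) ** g x = Q x ** (H (\<phi> x) ** h (\<phi> x)) ** J x"
    unfolding g_eq by (metis matrix_mul_assoc matrix_mul_lid)
  then show ?thesis by (simp add: inverse Q_J)
qed

lemma partial_h: "partial_matrix k (\<lambda>x. h (\<phi> x)) x = h (\<phi> x) ** Om k x + transpose (Om k x) ** h (\<phi> x)"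
  by (simp add: partial_matrix_compose[OF diff_h] connection_compatible[OF inverse sym] Om_def
      sum_matrix_mult transpose_sum scaleR_add_right sum.distrib)

text \<open>The gauge transformation law. Its right side is torsion free, by symmetry of the Hessian
  of \<open>\<phi>\<close> and of the Christoffel symbols of \<open>h\<close>, and compatible with
  \<open>g\<close> by the product rule, so uniqueness applies.\<close>

lemma connection_g_eq: "connection g k x = Q x ** (partial_matrix k J x + Om k x ** J x)"
proof (rule connection_unique[where W = "\<lambda>k. Q x ** (partial_matrix k J x + Om k x ** J x)"])
  show "(Q x ** H (\<phi> x) ** transpose (Q x)) ** g x = mat 1" by (rule g_inverse)
  show "transpose (g x) = g x" by (rule g_sym)
next
  fix i j k
  have "(Om k x ** J x) $ a $ j = (Om j x ** J x) $ a $ k" for a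
  proof -
    have "(Om k x ** J x) $ a $ j = (\<Sum>p\<in>UNIV. \<Sum>b\<in>UNIV. J x $ b $ k * connection h b (\<phi> x) $ a $ p * J x $ p $ j)" for k j
      by (simp add: Om_def matrix_matrix_mult_def sum_distrib_right)
    moreover have "(\<Sum>p\<in>UNIV. \<Sum>b\<in>UNIV. J x $ b $ k * connection h b (\<phi> x) $ a $ p * J x $ p $ j) =
        (\<Sum>p\<in>UNIV. \<Sum>b\<in>UNIV. J x $ b $ j * connection h b (\<phi> x) $ a $ p * J x $ p $ k)"
      by (subst sum.swap, intro sum.cong refl, subst connection_torsion_free[OF sym]) (simp add: mult_ac)
    ultimately show ?thesis by simp
  qed
  then show "(Q x ** (partial_matrix k J x + Om k x ** J x)) $ i $ j = (Q x ** (partial_matrix j J x + Om j x ** J x)) $ i $ k"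
    unfolding matrix_matrix_mult_def[of "Q x"] using partial_J_sym by simp
next
  fix k
  let ?S = "partial_matrix k J x + Om k x ** J x"
  have 1: "g x ** (Q x ** ?S) = transpose (J x) ** h (\<phi> x) ** ?S"
    unfolding g_eq by (metis matrix_mul_assoc J_Q matrix_mul_rid)
  have "transpose (Q x ** ?S) ** g x = transpose (g x ** (Q x ** ?S))"
    by (simp add: matrix_transpose_mul g_sym matrix_mul_assoc)
  also have "\<dots> = transpose ?S ** h (\<phi> x) ** J x"
    unfolding 1 by (simp add: matrix_transpose_mul sym matrix_mul_assoc)
  finally have 2: "transpose (Q x ** ?S) ** g x = transpose ?S ** h (\<phi> x) ** J x" .
  have d: "differentiable_entries (\<lambda>x. transpose (J x))"
    using differentiable_J(1) by (simp add: differentiable_entries_def transpose_nth)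
  have "partial_matrix k g x =
      partial_matrix k (\<lambda>x. transpose (J x) ** h (\<phi> x)) x ** J x + transpose (J x) ** h (\<phi> x) ** partial_matrix k J x"
    unfolding g_eq[abs_def] using d
    by (intro partial_matrix_mult differentiable_entries_mult differentiable_J differentiable_entries_compose diff_h)
  also have "partial_matrix k (\<lambda>x. transpose (J x) ** h (\<phi> x)) x =
      transpose (partial_matrix k J x) ** h (\<phi> x) + transpose (J x) ** partial_matrix k (\<lambda>x. h (\<phi> x)) x"
    using d by (subst partial_matrix_mult) (simp_all add: differentiable_entries_compose diff_h partial_matrix_transpose)
  finally show "partial_matrix k g x = g x ** (Q x ** ?S) + transpose (Q x ** ?S) ** g x"
    unfolding 1 2 partial_h
    by (simp add: matrix_add_ldistrib matrix_mult_add_left matrix_mul_assoc matrix_transpose_mul)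
qed

lemma J_connection: "J x ** connection g k x = partial_matrix k J x + Om k x ** J x"
  unfolding connection_g_eq by (metis matrix_mul_assoc J_Q matrix_mul_lid)

lemma differentiable_connection_g: "differentiable_entries (connection g k)"
  unfolding connection_g_eq[abs_def]
  by (intro differentiable_entries_mult differentiable_entries_add differentiable_J differentiable_Om)

text \<open>Differentiating the transformation law after multiplication by \<open>J\<close> keeps
  derivatives of the inverse \<open>Q\<close> out of the computation.\<close>

lemma partial_J_connection:
  "partial_matrix k J x ** connection g l x + J x ** partial_matrix k (connection g l) x =
    partial_matrix k (partial_matrix l J) x + (partial_matrix k (Om l) x ** J x + Om l x ** partial_matrix k J x)"
proof -
  have "partial_matrix k (\<lambda>x. J x ** connection g l x) x =
      partial_matrix k (\<lambda>x. partial_matrix l J x + Om l x ** J x) x"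
    by (simp only: J_connection)
  then show ?thesis
    by (simp add: partial_matrix_mult partial_matrix_add differentiable_connection_g differentiable_J
        differentiable_entries_mult differentiable_Om)
qed

definition curvature_at_image :: "'n \<Rightarrow> 'n \<Rightarrow> real^'n \<Rightarrow> real^'n^'n" where
  "curvature_at_image k l x = (\<Sum>b\<in>UNIV. \<Sum>c\<in>UNIV. (J x $ c $ k * J x $ b $ l) *\<^sub>R curvature h c b (\<phi> x))"

text \<open>Pulling back commutes with forming the curvature: the terms with second derivatives of
  \<open>\<phi>\<close> are symmetric in \<open>k\<close> and \<open>l\<close> and cancel.\<close>

lemma curvature_Om:
  "partial_matrix k (Om l) x - partial_matrix l (Om k) x + (Om k x ** Om l x - Om l x ** Om k x) =
    curvature_at_image k l x"
proof -
  let ?D = "\<lambda>c b. partial_matrix c (connection h b) (\<phi> x)"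
  let ?C = "\<lambda>b. connection h b (\<phi> x)"
  have P: "partial_matrix k (Om l) x = (\<Sum>b\<in>UNIV. partial_matrix k J x $ b $ l *\<^sub>R ?C b)
     + (\<Sum>b\<in>UNIV. \<Sum>c\<in>UNIV. (J x $ c $ k * J x $ b $ l) *\<^sub>R ?D c b)" for k l
    by (simp add: partial_Om sum.distrib scaleR_sum_right mult.commute)
  have O: "Om k x ** Om l x = (\<Sum>b\<in>UNIV. \<Sum>c\<in>UNIV. (J x $ c $ k * J x $ b $ l) *\<^sub>R (?C c ** ?C b))" for k l
    unfolding Om_def by (simp add: sum_matrix_mult scaleR_sum_right mult.commute)
  \<comment> \<open>Renaming the summation indices gives both halves of the antisymmetrization the
    same coefficients.\<close>
  have swap: "(\<Sum>b\<in>UNIV. \<Sum>c\<in>UNIV. (J x $ c $ l * J x $ b $ k) *\<^sub>R M c b) =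
      (\<Sum>b\<in>UNIV. \<Sum>c\<in>UNIV. (J x $ c $ k * J x $ b $ l) *\<^sub>R M b c)" for M :: "'n \<Rightarrow> 'n \<Rightarrow> real^'n^'n"
    by (subst sum.swap) (simp add: mult.commute)
  have "(\<Sum>b\<in>UNIV. partial_matrix k J x $ b $ l *\<^sub>R ?C b) = (\<Sum>b\<in>UNIV. partial_matrix l J x $ b $ k *\<^sub>R ?C b)"
    using partial_J_sym by simp
  then show ?thesis
    unfolding P O curvature_at_image_def curvature_def swap[of ?D] swap[of "\<lambda>c b. ?C c ** ?C b"]
    by (simp add: scaleR_add_right scaleR_diff_right sum.distrib sum_subtractf)
qed

text \<open>Tensoriality of the curvature. The terms with a first derivative of \<open>J\<close>
  cancel between the derivative and product parts, and its second derivatives cancel by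
  symmetry.\<close>

lemma J_curvature: "J x ** curvature g k l x = curvature_at_image k l x ** J x"
proof -
  have "J x ** connection g k x ** connection g l x =
      partial_matrix k J x ** connection g l x + Om k x ** (partial_matrix l J x + Om l x ** J x)" for k l
    unfolding J_connection matrix_mult_add_left
    by (simp add: matrix_mul_assoc[symmetric] J_connection)
  then have "J x ** (connection g k x ** connection g l x) =
      partial_matrix k J x ** connection g l x + Om k x ** partial_matrix l J x + Om k x ** Om l x ** J x" for k l
    by (simp add: matrix_mul_assoc matrix_add_ldistrib)
  moreover have "J x ** partial_matrix k (connection g l) x =
    partial_matrix k (partial_matrix l J) x + (partial_matrix k (Om l) x ** J x + Om l x ** partial_matrix k J x)
    - partial_matrix k J x ** connection g l x" for k l
    using partial_J_connection[of k x l] by (simp add: algebra_simps)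
  ultimately show ?thesis
    unfolding curvature_Om[symmetric] curvature_def matrix_add_ldistrib matrix_mult_diff_right
      matrix_mult_add_left matrix_mult_diff_left
    using partial_partial_J_sym[of k l x] by simp
qed

text \<open>The curvature of \<open>g\<close> is that of \<open>h\<close> conjugated by
  \<open>J\<close>. In the Ricci contraction the sum over \<open>i\<close> pairs a \<open>J\<close>
  from a form slot with the \<open>Q\<close> of the output slot, and their product is the
  identity.\<close>

theorem ricci_pullback: "ricci (pullback \<phi> h) x = transpose (J x) ** ricci h (\<phi> x) ** J x"
proof -
  let ?C = "\<lambda>c b. curvature h c b (\<phi> x)"
  have curv: "curvature g k l x = Q x ** curvature_at_image k l x ** J x" for k l
    by (metis J_curvature Q_J matrix_mul_assoc matrix_mul_lid)
  have "ricci g x $ j $ l = (transpose (J x) ** ricci h (\<phi> x) ** J x) $ j $ l" for j l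
  proof -
    have JQ: "(\<Sum>i\<in>UNIV. J x $ c $ i * Q x $ i $ a) = (if c = a then 1 else 0)" for c a
      using arg_cong[OF J_Q[of x], of "\<lambda>M. M $ c $ a"] by (simp add: matrix_matrix_mult_def mat_def)
    have tr: "(\<Sum>i\<in>UNIV. (Q x ** curvature_at_image i l x) $ i $ d) = (\<Sum>b\<in>UNIV. J x $ b $ l * (\<Sum>a\<in>UNIV. ?C a b $ a $ d))" for d
    proof -
      have "(\<Sum>i\<in>UNIV. (Q x ** curvature_at_image i l x) $ i $ d) =
          (\<Sum>i\<in>UNIV. \<Sum>a\<in>UNIV. \<Sum>b\<in>UNIV. \<Sum>c\<in>UNIV. J x $ b $ l * ?C c b $ a $ d * (J x $ c $ i * Q x $ i $ a))"
        by (simp add: matrix_matrix_mult_def curvature_at_image_def sum_distrib_left mult_ac)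
      also have "\<dots> = (\<Sum>a\<in>UNIV. \<Sum>b\<in>UNIV. \<Sum>c\<in>UNIV. \<Sum>i\<in>UNIV. J x $ b $ l * ?C c b $ a $ d * (J x $ c $ i * Q x $ i $ a))"
        by (subst sum.swap, rule sum.cong[OF refl], subst sum.swap, rule sum.cong[OF refl], rule sum.swap)
      also have "\<dots> = (\<Sum>a\<in>UNIV. \<Sum>b\<in>UNIV. J x $ b $ l * ?C a b $ a $ d)"
        by (simp add: sum_distrib_left[symmetric] JQ if_distrib[of "\<lambda>y. _ * y"] cong: if_cong)
      also have "\<dots> = (\<Sum>b\<in>UNIV. J x $ b $ l * (\<Sum>a\<in>UNIV. ?C a b $ a $ d))"
        by (subst sum.swap) (simp add: sum_distrib_left)
      finally show ?thesis .
    qed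
    have "ricci g x $ j $ l = (\<Sum>i\<in>UNIV. \<Sum>d\<in>UNIV. (Q x ** curvature_at_image i l x) $ i $ d * J x $ d $ j)"
      by (simp add: ricci_def riemann_eq_curvature curv matrix_matrix_mult_def[of _ "J x"])
    also have "\<dots> = (\<Sum>d\<in>UNIV. (\<Sum>b\<in>UNIV. J x $ b $ l * ricci h (\<phi> x) $ d $ b) * J x $ d $ j)"
      by (subst sum.swap) (simp add: sum_distrib_right[symmetric] tr ricci_def riemann_eq_curvature)
    also have "\<dots> = (transpose (J x) ** (ricci h (\<phi> x) ** J x)) $ j $ l"
      by (simp add: matrix_matrix_mult_def transpose_nth mult_ac)
    finally show ?thesis by (simp add: matrix_mul_assoc)
  qed
  then show ?thesis by (simp add: vec_eq_iff g_def)
qed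

end

section \<open>Reduction to linear algebra\<close>

text \<open>The regularity required of the target metric by \<open>metric_pullback\<close>.\<close>

lemma (in single_coordinate_metric) differentiable_metric:
  "differentiable_entries metric" "differentiable_entries (connection metric k)"
proof -
  have comp: "(\<lambda>x :: real^'n. f (x $ c)) differentiable (at x)"
    if "(f has_real_derivative d) (at (x $ c))" for f d x
    using differentiable_chain_at[of "\<lambda>x :: real^'n. x $ c" x f]
      bounded_linear_imp_differentiable[OF bounded_linear_vec_nth] that
    by (auto simp: o_def real_differentiable_def)
  show "differentiable_entries (connection metric k)"
    unfolding differentiable_entries_def connection_def
    by (auto simp: christoffel_metric[abs_def] intro!: comp Chr_has_derivative)
  have "(\<lambda>y. G (y $ c) $ a $ b) differentiable (at x)" for a b x
    using comp[of "\<lambda>t. G t $ a $ b" _ x] deriv_G[of "x $ c"] unfolding has_vector_derivative_matrix_iff by blast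
  then show "differentiable_entries metric"
    by (simp add: differentiable_entries_def metric_def)
qed

section \<open>Block matrices with one additional index\<close>

lemma sum_option: "(\<Sum>i\<in>UNIV. f i) = f None + (\<Sum>i\<in>UNIV. f (Some i))" for f :: "'m::finite option \<Rightarrow> real"
  by (simp add: UNIV_option_conv sum.reindex)

definition extend_by_zero :: "real^'m^'m \<Rightarrow> real^('m::finite option)^('m::finite option)" where
  "extend_by_zero B = (\<chi> i j. case (i, j) of (Some i', Some j') \<Rightarrow> B $ i' $ j' | _ \<Rightarrow> 0)"

lemma vec_option_eq_iff: "x = y \<longleftrightarrow> x $ None = y $ None \<and> (\<forall>i. x $ Some i = y $ Some i)"
  by (metis not_Some_eq vec_eq_iff)

lemma extend_by_one_nth [simp]:
  "extend_by_one B $ None $ None = 1" "extend_by_one B $ None $ Some j = 0"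
  "extend_by_one B $ Some i $ None = 0" "extend_by_one B $ Some i $ Some j = B $ i $ j"
  by (simp_all add: extend_by_one_def)

lemma extend_by_zero_nth [simp]:
  "extend_by_zero B $ None $ j' = 0" "extend_by_zero B $ i' $ None = 0"
  "extend_by_zero B $ Some i $ Some j = B $ i $ j"
  by (simp_all add: extend_by_zero_def split: option.split)

lemma extend_mult:
  "extend_by_one A ** extend_by_one B = extend_by_one (A ** B)"
  "extend_by_one A ** extend_by_zero B = extend_by_zero (A ** B)"
  "extend_by_zero A ** extend_by_one B = extend_by_zero (A ** B)"
  "extend_by_zero A ** extend_by_zero B = extend_by_zero (A ** B)"
  by (simp_all add: vec_option_eq_iff matrix_matrix_mult_def sum_option)

lemma extend_by_one_mat_1 [simp]: "extend_by_one (mat 1) = mat 1"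
  by (simp add: vec_option_eq_iff mat_def)

lemma transpose_extend:
  "transpose (extend_by_one A) = extend_by_one (transpose A)"
  "transpose (extend_by_zero A) = extend_by_zero (transpose A)"
  by (simp_all add: vec_option_eq_iff transpose_nth)

lemma extend_by_zero_linear:
  "extend_by_zero (A + B) = extend_by_zero A + extend_by_zero B"
  "extend_by_zero (A - B) = extend_by_zero A - extend_by_zero B"
  "extend_by_zero (c *\<^sub>R A) = c *\<^sub>R extend_by_zero A"
  "extend_by_zero (- A) = - extend_by_zero A"
  by (simp_all add: vec_option_eq_iff)

lemma extend_by_zero_eq_0_iff [simp]: "extend_by_zero A = 0 \<longleftrightarrow> A = 0"
  by (auto simp: vec_option_eq_iff vec_eq_iff)

lemma trace_extend_by_zero [simp]: "trace (extend_by_zero A) = trace A"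
  by (simp add: trace_def sum_option)

lemma extend_by_one_has_vector_derivative:
  assumes "(M has_vector_derivative M') (at t)"
  shows "((\<lambda>t. extend_by_one (M t)) has_vector_derivative extend_by_zero M') (at t)"
  unfolding has_vector_derivative_matrix_iff
proof (intro allI)
  fix i j
  show "((\<lambda>t. extend_by_one (M t) $ i $ j) has_real_derivative extend_by_zero M' $ i $ j) (at t)"
    using assms by (cases i; cases j) (auto simp: has_vector_derivative_matrix_iff)
qed

definition outer :: "real^'n \<Rightarrow> real^'n \<Rightarrow> real^'n^'n" where
  "outer u v = (\<chi> i j. u $ i * v $ j)"

lemma outer_nth [simp]: "outer u v $ i $ j = u $ i * v $ j"
  by (simp add: outer_def)

lemma congruence_outer: "transpose F ** outer u v ** F = outer (u v* F) (v v* F)"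
  by (simp add: vec_eq_iff matrix_matrix_mult_def vector_matrix_mult_def transpose_nth
      sum_distrib_left sum_distrib_right mult_ac)

lemma row_matrix_mult: "(A ** B) $ i = A $ i v* (B :: real^'n^'n)"
  by (simp add: vec_eq_iff matrix_matrix_mult_def vector_matrix_mult_def mult.commute)

section \<open>The left-invariant metric for a symmetric involution \<open>\<eta>\<close>\<close>

locale almost_abelian =
  fixes A :: "real^'m^'m::finite" and \<eta> :: "real^('m option)^('m option)"
  assumes \<eta>_sym: "transpose \<eta> = \<eta>" and \<eta>_involution: "\<eta> ** \<eta> = mat 1"
begin

definition F :: "real \<Rightarrow> real^('m option)^('m option)" where
  "F t = extend_by_one (matrix_exp (t *\<^sub>R (- A)))"

definition F_inv :: "real \<Rightarrow> real^('m option)^('m option)" where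
  "F_inv t = extend_by_one (matrix_exp (t *\<^sub>R A))"

definition N :: "real^('m option)^('m option)" where "N = extend_by_zero A"

text \<open>\<open>N\<close> plus its adjoint with respect to \<open>\<eta>\<close>, hence twice the
  self-adjoint part of \<open>N\<close>.\<close>

definition B\<^sub>0 :: "real^('m option)^('m option)" where "B\<^sub>0 = N + \<eta> ** transpose N ** \<eta>"

definition G :: "real \<Rightarrow> real^('m option)^('m option)" where "G t = transpose (F t) ** \<eta> ** F t"

definition H :: "real \<Rightarrow> real^('m option)^('m option)" where "H t = F_inv t ** \<eta> ** transpose (F_inv t)"

definition B :: "real \<Rightarrow> real^('m option)^('m option)" where "B t = F_inv t ** B\<^sub>0 ** F t"

lemma F_inv_F: "F_inv t ** F t = mat 1"
  using matrix_exp_minus[of t "- A"] by (simp add: F_def F_inv_def extend_mult)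

lemma F_F_inv: "F t ** F_inv t = mat 1"
  using F_inv_F matrix_left_right_inverse by blast

lemma N_F: "N ** F t = F t ** N" "N ** F_inv t = F_inv t ** N"
  unfolding N_def F_def F_inv_def extend_mult
  by (rule arg_cong[of _ _ extend_by_zero], rule matrix_exp_intertwines, simp)+

lemma cancel_F: "X ** F t ** F_inv t = X" "X ** F t ** N = X ** N ** F t"
  by (simp_all add: matrix_mul_assoc[symmetric] F_F_inv N_F)

lemma F_derivative: "(F has_vector_derivative - (N ** F t)) (at t)"
  using extend_by_one_has_vector_derivative[OF matrix_exp_has_vector_derivative[of "- A" t]]
  by (simp add: F_def[abs_def] N_def extend_mult extend_by_zero_linear)

lemma F_inv_derivative: "(F_inv has_vector_derivative N ** F_inv t) (at t)"
  using extend_by_one_has_vector_derivative[OF matrix_exp_has_vector_derivative[of A t]]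
  by (simp add: F_inv_def[abs_def] N_def extend_mult)

lemma G_B: "G t ** B t = transpose (F t) ** (\<eta> ** B\<^sub>0) ** F t"
  by (simp add: G_def B_def matrix_mul_assoc cancel_F)

lemma \<eta>_B\<^sub>0: "\<eta> ** B\<^sub>0 = \<eta> ** N + transpose N ** \<eta>"
  by (simp add: B\<^sub>0_def matrix_add_ldistrib matrix_mul_assoc \<eta>_involution)

lemma B_H: "B t ** H t = F_inv t ** (B\<^sub>0 ** \<eta>) ** transpose (F_inv t)"
  by (simp add: H_def B_def matrix_mul_assoc cancel_F)

lemma B\<^sub>0_\<eta>: "B\<^sub>0 ** \<eta> = N ** \<eta> + \<eta> ** transpose N"
  by (simp add: B\<^sub>0_def matrix_mult_add_left matrix_mul_assoc[symmetric] \<eta>_involution)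

sublocale single_coordinate_metric G H B N None "trace A" "\<eta> $ None $ None"
proof
  fix t
  have "transpose (F_inv t) ** transpose (F t) = mat 1"
    by (simp add: matrix_transpose_mul[symmetric] F_F_inv)
  moreover have "H t ** G t = F_inv t ** \<eta> ** (transpose (F_inv t) ** transpose (F t)) ** \<eta> ** F t"
    by (simp add: G_def H_def matrix_mul_assoc)
  ultimately have "H t ** G t = F_inv t ** (\<eta> ** \<eta>) ** F t" by (simp add: matrix_mul_assoc)
  then show "H t ** G t = mat 1" by (simp add: \<eta>_involution F_inv_F)
  show "transpose (G t) = G t"
    by (simp add: G_def matrix_transpose_mul \<eta>_sym matrix_mul_assoc)
  show "transpose (G t ** B t) = G t ** B t"
    by (simp add: G_B \<eta>_B\<^sub>0 matrix_transpose_mul \<eta>_sym matrix_mul_assoc add.commute)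
  have "(G has_vector_derivative transpose (F t) ** \<eta> ** - (N ** F t) +
      (transpose (F t) ** 0 + transpose (- (N ** F t)) ** \<eta>) ** F t) (at t)"
    unfolding G_def[abs_def]
    by (intro matrix_mult_has_vector_derivative transpose_has_vector_derivative F_derivative
        has_vector_derivative_const)
  then show "(G has_vector_derivative - (G t ** B t)) (at t)"
    by (simp add: G_B \<eta>_B\<^sub>0 matrix_transpose_mul matrix_add_ldistrib matrix_mult_add_left matrix_mul_assoc)
  have "(H has_vector_derivative F_inv t ** \<eta> ** transpose (N ** F_inv t) +
      (F_inv t ** 0 + N ** F_inv t ** \<eta>) ** transpose (F_inv t)) (at t)"
    unfolding H_def[abs_def]
    by (intro matrix_mult_has_vector_derivative transpose_has_vector_derivative F_inv_derivative
        has_vector_derivative_const)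
  moreover have "transpose (N ** F_inv t) = transpose N ** transpose (F_inv t)"
    by (simp add: N_F matrix_transpose_mul)
  ultimately show "(H has_vector_derivative B t ** H t) (at t)"
    by (simp add: B_H B\<^sub>0_\<eta> N_F matrix_add_ldistrib matrix_mult_add_left matrix_mul_assoc add.commute)
  have "(B has_vector_derivative F_inv t ** B\<^sub>0 ** - (N ** F t) +
      (F_inv t ** 0 + N ** F_inv t ** B\<^sub>0) ** F t) (at t)"
    unfolding B_def[abs_def]
    by (intro matrix_mult_has_vector_derivative F_derivative F_inv_derivative has_vector_derivative_const)
  then show "(B has_vector_derivative N ** B t - B t ** N) (at t)"
    by (simp add: B_def matrix_mul_assoc) (simp add: N_F(1) matrix_mul_assoc[symmetric])
  \<comment> \<open>The last row of \<open>F_inv\<close> is constant, so the corner of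
    \<open>H\<close> is the corner of \<open>\<eta>\<close> for every \<open>t\<close>.\<close>
  have row: "F_inv t $ None $ j = (if j = None then 1 else 0)" for j
    by (cases j) (simp_all add: F_inv_def)
  show "H t $ None $ None = \<eta> $ None $ None"
    by (simp add: H_def matrix_matrix_mult_def transpose_nth row if_distrib[of "\<lambda>x. x * _"]
        if_distrib[of "\<lambda>x. _ * x"] cong: if_cong)
  show "N $ None = 0" by (simp add: N_def vec_eq_iff)
  have "trace (B t) = trace (F_inv t ** (B\<^sub>0 ** F t))"
    by (simp add: B_def matrix_mul_assoc)
  also have "\<dots> = trace (B\<^sub>0 ** F t ** F_inv t)" by (rule trace_mul_sym)
  also have "\<dots> = trace N + trace (\<eta> ** transpose N ** \<eta>)"
    by (simp add: cancel_F B\<^sub>0_def trace_add)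
  also have "trace (\<eta> ** transpose N ** \<eta>) = trace (\<eta> ** (\<eta> ** transpose N))" by (rule trace_mul_sym)
  finally show "trace (B t) = 2 * trace A"
    by (simp add: matrix_mul_assoc \<eta>_involution N_def)
qed

lemma metric_eq: "metric = almost_abelian_metric A \<eta>"
  by (simp add: fun_eq_iff metric_def almost_abelian_metric_def G_def F_def transpose_extend
      transpose_matrix_exp)

text \<open>The Ricci tensor (doubled and transposed) in the left-invariant coframe given by \<^term>\<open>F\<close>.\<close>

definition ricci_form :: "real^('m option)^('m option)" where
  "ricci_form = (let e = axis None 1; r = (B\<^sub>0 ** N) $ None + trace A *\<^sub>R B\<^sub>0 $ None in
     outer e r + outer r e + (\<eta> $ None $ None) *\<^sub>R (\<eta> ** (N ** B\<^sub>0 - B\<^sub>0 ** N - trace A *\<^sub>R B\<^sub>0))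
     - (trace (B\<^sub>0 ** B\<^sub>0) / 2) *\<^sub>R outer e e - outer (B\<^sub>0 $ None) (B\<^sub>0 $ None))"

text \<open>The last rows of \<open>F\<close> and \<open>F_inv\<close> are the unit row
  \<open>e\<close>, so the rows in \<open>ricci_metric\<close> are constant rows times
  \<open>F\<close>; the bilinear term is a constant one congruent by \<open>F\<close>, and the trace
  is unchanged by conjugation.\<close>

lemma ricci_eq_ricci_form:
  assumes t: "t = x $ None"
  shows "2 *\<^sub>R transpose (ricci metric x) = transpose (F t) ** ricci_form ** F t"
proof -
  define e :: "real^('m option)" where "e = axis None 1"
  have row_F_inv: "F_inv t $ None = e"
    unfolding vec_eq_iff by (intro allI, rename_tac j, case_tac j) (simp_all add: F_inv_def e_def axis_def)
  have row_F: "F t $ None = e"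
    unfolding vec_eq_iff by (intro allI, rename_tac j, case_tac j) (simp_all add: F_def e_def axis_def)
  have e_mult: "e v* M = M $ None" for M :: "real^('m option)^('m option)"
    by (simp add: e_def vec_eq_iff vector_matrix_mult_def axis_def if_distrib[of "\<lambda>x. x * _"] cong: if_cong)
  have row_B: "B t $ None = B\<^sub>0 $ None v* F t"
    by (simp add: B_def row_matrix_mult row_F_inv e_mult)
  have row_BN: "(B t ** N) $ None = (B\<^sub>0 ** N) $ None v* F t"
  proof -
    have "B t ** N = F_inv t ** (B\<^sub>0 ** N ** F t)"
      by (simp add: B_def matrix_mul_assoc cancel_F)
    then show ?thesis by (simp add: row_matrix_mult[of "F_inv t"] row_F_inv e_mult row_matrix_mult[of "B\<^sub>0 ** N"])
  qed
  have trace_BB: "trace (B t ** B t) = trace (B\<^sub>0 ** B\<^sub>0)"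
  proof -
    have "B t ** B t = F_inv t ** (B\<^sub>0 ** B\<^sub>0 ** F t)"
      by (simp add: B_def matrix_mul_assoc cancel_F)
    then have "trace (B t ** B t) = trace (B\<^sub>0 ** B\<^sub>0 ** F t ** F_inv t)"
      by (simp add: trace_mul_sym[of "F_inv t"])
    then show ?thesis by (simp add: cancel_F)
  qed
  define Y where "Y = \<eta> ** (N ** B\<^sub>0 - B\<^sub>0 ** N - trace A *\<^sub>R B\<^sub>0)"
  define r where "r = (B\<^sub>0 ** N) $ None + trace A *\<^sub>R B\<^sub>0 $ None"
  have Y: "G t ** (N ** B t - B t ** N) - trace A *\<^sub>R K t = transpose (F t) ** Y ** F t"
  proof -
    have "G t ** (N ** B t) = transpose (F t) ** (\<eta> ** (N ** B\<^sub>0)) ** F t"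
      by (simp add: G_def B_def matrix_mul_assoc cancel_F)
    moreover have "G t ** (B t ** N) = transpose (F t) ** (\<eta> ** (B\<^sub>0 ** N)) ** F t"
      by (simp add: G_def B_def matrix_mul_assoc cancel_F)
    moreover have "K t = transpose (F t) ** (\<eta> ** B\<^sub>0) ** F t"
      by (simp add: K_def G_B)
    ultimately show ?thesis
      unfolding Y_def by (simp add: matrix_mult_diff_left matrix_mult_diff_right)
  qed
  have "2 *\<^sub>R transpose (ricci metric x) = outer e ((B t ** N) $ None + trace A *\<^sub>R B t $ None)
      + outer ((B t ** N) $ None + trace A *\<^sub>R B t $ None) e
      + (\<eta> $ None $ None) *\<^sub>R (transpose (F t) ** Y ** F t)
      - (trace (B\<^sub>0 ** B\<^sub>0) / 2) *\<^sub>R outer e e - outer (B t $ None) (B t $ None)"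
    unfolding Y[symmetric]
    by (simp add: vec_eq_iff transpose_nth ricci_metric[OF t] e_def axis_def \<delta>_def trace_BB algebra_simps)
  also have "(B t ** N) $ None + trace A *\<^sub>R B t $ None = r v* F t"
    by (simp add: row_BN row_B r_def vec_eq_iff vector_matrix_mult_def sum.distrib distrib_left
        sum_distrib_left mult_ac)
  also have "outer e (r v* F t) + outer (r v* F t) e
      + (\<eta> $ None $ None) *\<^sub>R (transpose (F t) ** Y ** F t)
      - (trace (B\<^sub>0 ** B\<^sub>0) / 2) *\<^sub>R outer e e - outer (B t $ None) (B t $ None) =
      transpose (F t) ** (outer e r + outer r e + (\<eta> $ None $ None) *\<^sub>R Y
      - (trace (B\<^sub>0 ** B\<^sub>0) / 2) *\<^sub>R outer e e - outer (B\<^sub>0 $ None) (B\<^sub>0 $ None)) ** F t"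
    using e_mult[of "F t"]
    by (simp add: matrix_add_ldistrib matrix_mult_add_left matrix_mult_diff_left matrix_mult_diff_right
        congruence_outer row_F row_B)
  finally show ?thesis by (simp add: ricci_form_def Let_def Y_def r_def e_def)
qed

text \<open>\<open>F 0\<close> is the identity, so the value at the origin determines the form;
  conversely, congruence carries the zero form to zero everywhere.\<close>

lemma ricci_flat_iff: "ricci_flat (almost_abelian_metric A \<eta>) \<longleftrightarrow> ricci_form = 0"
proof
  assume "ricci_flat (almost_abelian_metric A \<eta>)"
  then have "ricci metric 0 = 0" by (simp add: ricci_flat_def metric_eq)
  moreover have "transpose 0 = (0 :: real^('m option)^('m option))"
    by (simp add: vec_eq_iff transpose_nth)
  ultimately have "transpose (F 0) ** ricci_form ** F 0 = 0"
    using ricci_eq_ricci_form[of 0 0] by simp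
  then show "ricci_form = 0" by (simp add: F_def)
next
  assume "ricci_form = 0"
  then have "transpose (ricci metric x) = 0" for x
    using ricci_eq_ricci_form[of "x $ None" x] by simp
  then have "ricci metric x = transpose 0" for x by (metis transpose_transpose)
  then show "ricci_flat (almost_abelian_metric A \<eta>)"
    by (simp add: ricci_flat_def metric_eq transpose_def zero_vec_def)
qed

lemma isometric_ricci_flat:
  assumes "isometric g (almost_abelian_metric A \<eta>)" "ricci_flat (almost_abelian_metric A \<eta>)"
  shows "ricci_flat g"
proof -
  obtain \<phi> where \<phi>: "diffeomorphism \<phi>" "g = pullback \<phi> metric"
    using assms(1) by (auto simp: isometric_def metric_eq)
  interpret metric_pullback \<phi> metric "\<lambda>y. H (y $ None)"
    by unfold_locales (use \<phi> sym inverse differentiable_metric in \<open>auto simp: metric_def\<close>)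
  show ?thesis
    using assms(2) ricci_pullback unfolding ricci_flat_def metric_eq[symmetric] \<phi>(2) by simp
qed

end

section \<open>Block diagonal forms: flatness through traces and commutators\<close>

lemma trace_square_symmetric:
  fixes S :: "real^'m^'m"
  assumes "transpose S = S"
  shows "trace (S ** S) = 0 \<longleftrightarrow> S = 0"
proof -
  have "trace (S ** S) = trace (S ** transpose S)" using assms by simp
  also have "\<dots> = (\<Sum>i\<in>UNIV. \<Sum>j\<in>UNIV. (S $ i $ j)\<^sup>2)"
    by (simp add: trace_def matrix_matrix_mult_def transpose_nth power2_eq_square)
  finally show ?thesis
    by (simp add: sum_nonneg_eq_0_iff sum_nonneg vec_eq_iff)
qed

lemma trace_commutator: "trace (A ** B - B ** A) = 0" for A B :: "real^'m^'m"
  by (simp add: trace_sub trace_mul_sym[of A])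

text \<open>
  Here \<open>\<eta> = s (P \<oplus> 1)\<close>: case (a) is \<open>s = -1\<close>, \<open>P = -I\<close>, and case (b) is \<open>s = 1\<close>, \<open>P = J\<close>.
\<close>

locale block_diagonal =
  fixes A S T P :: "real^'m^'m::finite" and s :: real
  assumes decomposition: "A = S + T"
    and S: "transpose S = P ** S ** P" and T: "transpose T = - (P ** T ** P)"
    and P: "transpose P = P" "P ** P = mat 1" and s: "s * s = 1"
begin

sublocale almost_abelian A "s *\<^sub>R extend_by_one P"
  by unfold_locales (simp_all add: transpose_extend extend_mult P s)

text \<open>Conjugating the transpose by \<open>P\<close> is the adjoint for the form
  \<open>P\<close>; it fixes \<open>S\<close> and negates \<open>T\<close>.\<close>

lemma P_transpose_A_P: "P ** transpose A ** P = S - T"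
proof -
  have "P ** (P ** X ** P) ** P = X" for X
    by (metis P(2) matrix_mul_assoc matrix_mul_lid matrix_mul_rid)
  then show ?thesis
    unfolding decomposition by (simp add: S T matrix_add_ldistrib matrix_mult_add_left matrix_mult_diff_left matrix_mult_diff_right)
qed

lemma B\<^sub>0_eq: "B\<^sub>0 = extend_by_zero (2 *\<^sub>R S)"
proof -
  have "B\<^sub>0 = extend_by_zero (A + P ** transpose A ** P)"
    by (simp add: B\<^sub>0_def N_def transpose_extend extend_mult extend_by_zero_linear s)
  also have "A + P ** transpose A ** P = 2 *\<^sub>R S"
    unfolding P_transpose_A_P by (simp add: decomposition vec_eq_iff)
  finally show ?thesis .
qed

text \<open>The last row of \<open>B\<^sub>0\<close> vanishes, so only the commutator block and the
  corner remain. The factor \<open>s\<close> from the corner entry and the one from the form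
  multiply to 1.\<close>

lemma ricci_form_eq:
  "ricci_form = extend_by_zero (P ** (2 *\<^sub>R (A ** S - S ** A - trace A *\<^sub>R S)))
    - (2 * trace (S ** S)) *\<^sub>R outer (axis None 1) (axis None 1)"
proof -
  have "outer u 0 = 0" "outer 0 u = 0" for u :: "real^('m option)"
    by (simp_all add: vec_eq_iff)
  moreover have "B\<^sub>0 $ None = 0" "(B\<^sub>0 ** N) $ None = 0"
    by (simp_all add: B\<^sub>0_eq N_def extend_mult vec_eq_iff)
  moreover have "N ** B\<^sub>0 - B\<^sub>0 ** N - trace A *\<^sub>R B\<^sub>0 =
      extend_by_zero (2 *\<^sub>R (A ** S - S ** A - trace A *\<^sub>R S))"
    by (simp add: B\<^sub>0_eq N_def extend_mult extend_by_zero_linear scaleR_diff_right)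
  ultimately show ?thesis
    unfolding ricci_form_def Let_def
    by (simp add: extend_mult s) (simp add: B\<^sub>0_eq extend_mult extend_by_zero_linear)
qed

text \<open>The two summands of \<open>ricci_form\<close> occupy disjoint entries and so vanish
  separately, and \<open>P\<close> is invertible.\<close>

lemma ricci_flat_iff_commutator:
  "ricci_flat (almost_abelian_metric A (s *\<^sub>R extend_by_one P)) \<longleftrightarrow>
    A ** S - S ** A = trace A *\<^sub>R S \<and> trace (S ** S) = 0"
proof -
  let ?M = "2 *\<^sub>R (A ** S - S ** A - trace A *\<^sub>R S)"
  have "ricci_form = 0 \<longleftrightarrow> trace (S ** S) = 0 \<and> P ** ?M = 0"
  proof
    assume *: "ricci_form = 0"
    have "ricci_form $ None $ None = - 2 * trace (S ** S)"
      by (simp add: ricci_form_eq axis_def)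
    then have tr: "trace (S ** S) = 0" using * by simp
    then have "extend_by_zero (P ** ?M) = 0"
      using * unfolding ricci_form_eq by simp
    then show "trace (S ** S) = 0 \<and> P ** ?M = 0" using tr by (simp only: extend_by_zero_eq_0_iff)
  next
    assume "trace (S ** S) = 0 \<and> P ** ?M = 0"
    then show "ricci_form = 0" unfolding ricci_form_eq by (simp only: extend_by_zero_eq_0_iff) simp
  qed
  moreover have "P ** M = 0 \<longleftrightarrow> M = 0" for M :: "real^'m^'m"
  proof
    assume "P ** M = 0"
    moreover have "M = P ** (P ** M)" by (simp add: matrix_mul_assoc P)
    ultimately show "M = 0" by simp
  qed simp
  moreover have "?M = 0 \<longleftrightarrow> A ** S - S ** A = trace A *\<^sub>R S" by simp
  ultimately show ?thesis unfolding ricci_flat_iff by blast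
qed

lemma trace_T: "trace T = 0"
proof -
  have "trace T = trace (transpose T)" by simp
  also have "\<dots> = - trace (P ** T ** P)" unfolding T by simp
  also have "trace (P ** T ** P) = trace T"
    by (metis P(2) matrix_mul_assoc matrix_mul_rid trace_mul_sym)
  finally show ?thesis by simp
qed

lemma ricci_flat_iff_trace:
  "ricci_flat (almost_abelian_metric A (s *\<^sub>R extend_by_one P)) \<longleftrightarrow>
    trace S = 0 \<and> trace (S ** S) = 0 \<and> T ** S = S ** T"
proof -
  have trA: "trace A = trace S" by (simp add: decomposition trace_add trace_T)
  have comm: "A ** S - S ** A = T ** S - S ** T"
    by (simp add: decomposition matrix_add_ldistrib matrix_mult_add_left)
  \<comment> \<open>Commutators are traceless, so taking traces gives that the square of
    \<open>trace S\<close> is zero.\<close>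
  have "trace S = 0" if "T ** S - S ** T = trace S *\<^sub>R S"
    using trace_commutator[of T S] that by simp
  then show ?thesis unfolding ricci_flat_iff_commutator comm trA by auto
qed

text \<open>Moving the left exponential across \<open>P\<close> turns \<open>transpose A\<close>
  into \<open>S - T\<close>, which commutes with \<open>S + T\<close>; the exponents add up to a
  multiple of \<open>S\<close>. As the right side is free of \<open>T\<close>, the matrices
  \<open>A\<close> and \<open>S\<close> define the same metric.\<close>

lemma metric_eq_symmetric_part:
  assumes "T ** S = S ** T"
  shows "almost_abelian_metric A (s *\<^sub>R extend_by_one P) x =
    s *\<^sub>R extend_by_one (P ** matrix_exp (- (x $ None) *\<^sub>R (2 *\<^sub>R S)))"
proof -
  define t where "t = - x $ None"
  have "P ** (S - T) = transpose A ** P"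
    unfolding P_transpose_A_P[symmetric] by (metis P(2) matrix_mul_assoc matrix_mul_lid)
  then have "P ** (t *\<^sub>R (S - T)) = (t *\<^sub>R transpose A) ** P" by simp
  then have "matrix_exp (t *\<^sub>R transpose A) ** P = P ** matrix_exp (t *\<^sub>R (S - T))"
    by (rule matrix_exp_intertwines[symmetric])
  then have "matrix_exp (t *\<^sub>R transpose A) ** P ** matrix_exp (t *\<^sub>R A) =
      P ** (matrix_exp (t *\<^sub>R (S - T)) ** matrix_exp (t *\<^sub>R (S + T)))"
    by (simp add: matrix_mul_assoc decomposition)
  also have "matrix_exp (t *\<^sub>R (S - T)) ** matrix_exp (t *\<^sub>R (S + T)) = matrix_exp (t *\<^sub>R (2 *\<^sub>R S))"
  proof -
    have "(S - T) ** (S + T) = (S + T) ** (S - T)"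
      using assms by (simp add: matrix_add_ldistrib matrix_mult_add_left matrix_mult_diff_left matrix_mult_diff_right)
    moreover have "S - T + (S + T) = 2 *\<^sub>R S" by (simp add: vec_eq_iff)
    ultimately show ?thesis using matrix_exp_add_commuting[of "S - T" "S + T" t] by simp
  qed
  finally show ?thesis
    by (simp add: almost_abelian_metric_def extend_mult t_def)
qed

end

section \<open>The identity map as an isometry\<close>

lemma C_k_const: "C_k k (\<lambda>x :: real^'n. c)"
proof (induction k arbitrary: c)
  case (Suc k)
  have "partial i (\<lambda>x :: real^'n. c) = (\<lambda>x. 0)" for i
    by (rule ext) (simp add: partial_eqI[OF has_derivative_const])
  then show ?case using Suc by simp
qed (simp add: continuous_on_const)

lemma C_k_nth: "C_k k (\<lambda>x :: real^'n. x $ i)"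
proof (cases k)
  case (Suc l)
  have d: "((\<lambda>x :: real^'n. x $ i) has_derivative (\<lambda>x. x $ i)) (at x)" for x
    by (rule bounded_linear_imp_has_derivative[OF bounded_linear_vec_nth])
  have "partial j (\<lambda>x :: real^'n. x $ i) = (\<lambda>x. axis j 1 $ i)" for j
    by (rule ext) (rule partial_eqI[OF d])
  then show ?thesis
    using Suc d by (auto simp: C_k_const differentiable_def)
qed (simp add: continuous_on_component)

lemma isometric_refl: "isometric g g" for g :: "real^'n \<Rightarrow> real^'n^'n"
proof -
  have d: "((\<lambda>x :: real^'n. x) has_derivative (\<lambda>x. x)) (at x)" for x by simp
  have "jacobian (\<lambda>x :: real^'n. x) (at x) = mat 1" for x
    unfolding jacobian_def frechet_derivative_at[OF d, symmetric]
    by (simp add: matrix_def mat_def axis_def vec_eq_iff)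
  then have "pullback (\<lambda>x. x) g = g"
    by (simp add: pullback_def fun_eq_iff)
  moreover have "inv (\<lambda>x :: real^'n. x) = (\<lambda>x. x)" using inv_id by (simp add: id_def)
  then have "diffeomorphism (\<lambda>x :: real^'n. x)"
    by (simp add: diffeomorphism_def smooth_map_def C_k_nth bij_betw_def)
  ultimately show ?thesis unfolding isometric_def by blast
qed

text \<open>For symmetric \<open>S\<close> the condition \<open>trace (S ** S) = 0\<close> already
  forces \<open>S = 0\<close>, from which the other two conditions of
  \<open>ricci_flat_iff_trace\<close> follow.\<close>

lemma ricci_flat_case_a:
  fixes A :: "real^'m^'m"
  assumes "A = S + T" "transpose S = S" "transpose T = - T"
  shows "ricci_flat (almost_abelian_metric A \<eta>_a) \<longleftrightarrow> S = 0"
proof -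
  interpret block_diagonal A S T "- mat 1" "-1"
    by unfold_locales (use assms in \<open>simp_all add: transpose_mat\<close>)
  have "\<eta>_a = (- 1) *\<^sub>R extend_by_one (- mat 1 :: real^'m^'m)"
    by (simp add: vec_option_eq_iff \<eta>_a_def mat_def)
  then show ?thesis
    using ricci_flat_iff_trace trace_square_symmetric[OF assms(2)] by (auto simp: trace_def simp del: scaleR_minus_left)
qed

lemma block_diagonal_minkowski:
  fixes A :: "real^'m::{finite,linorder}^'m::{finite,linorder}"
  assumes "A = S + T" "transpose S = J_minkowski ** S ** J_minkowski"
    "transpose T = - (J_minkowski ** T ** J_minkowski)"
  shows "block_diagonal A S T J_minkowski 1"
proof
  show "J_minkowski ** J_minkowski = (mat 1 :: real^'m::{finite,linorder}^'m::{finite,linorder})"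
    by (simp add: vec_eq_iff matrix_matrix_mult_def J_minkowski_def mat_def if_distrib[of "\<lambda>x. x * _"]
        cong: if_cong)
  show "transpose J_minkowski = (J_minkowski :: real^'m::{finite,linorder}^'m::{finite,linorder})"
    by (simp add: vec_eq_iff transpose_nth J_minkowski_def)
qed (use assms in simp_all)

text \<open>The pair \<open>S\<close>, \<open>0\<close> is a second instance of the locale, flat
  exactly when both traces vanish. If \<open>A\<close> gives a flat metric, then \<open>T\<close>
  and \<open>S\<close> commute, the two metrics coincide and the identity is an isometry;
  conversely, flatness is transported back from \<open>S\<close>.\<close>

lemma ricci_flat_case_b:
  fixes A :: "real^'m::{finite,linorder}^'m::{finite,linorder}"
  assumes "A = S + T" "transpose S = J_minkowski ** S ** J_minkowski"
    "transpose T = - (J_minkowski ** T ** J_minkowski)"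
  shows "ricci_flat (almost_abelian_metric A \<eta>_b) \<longleftrightarrow>
    trace S = 0 \<and> trace (S ** S) = 0 \<and>
    isometric (almost_abelian_metric A \<eta>_b) (almost_abelian_metric S \<eta>_b)"
proof -
  have \<eta>: "\<eta>_b = 1 *\<^sub>R extend_by_one (J_minkowski :: real^'m::{finite,linorder}^'m::{finite,linorder})"
    by (simp add: vec_option_eq_iff \<eta>_b_def J_minkowski_def vec_eq_iff)
  interpret A: block_diagonal A S T J_minkowski 1
    using assms by (rule block_diagonal_minkowski)
  interpret S: block_diagonal S S 0 J_minkowski 1
    using assms by (intro block_diagonal_minkowski) (simp_all add: vec_eq_iff transpose_nth)
  have S_flat: "ricci_flat (almost_abelian_metric S \<eta>_b) \<longleftrightarrow> trace S = 0 \<and> trace (S ** S) = 0"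
    unfolding \<eta> using S.ricci_flat_iff_trace by simp
  have "almost_abelian_metric A \<eta>_b = almost_abelian_metric S \<eta>_b" if "T ** S = S ** T"
  proof -
    have "0 ** S = S ** 0" by simp
    then show ?thesis
      unfolding \<eta> fun_eq_iff by (simp only: A.metric_eq_symmetric_part[OF that] S.metric_eq_symmetric_part simp_thms)
  qed
  then show ?thesis
    using A.ricci_flat_iff_trace S.isometric_ricci_flat S_flat isometric_refl unfolding \<eta> by metis
qed

section \<open>Case (c): the form with a hyperbolic plane\<close>

definition swap_last :: "'m::{finite,linorder} option \<Rightarrow> 'm option" where
  "swap_last i = (if i = None then Some last_index else if i = Some last_index then None else i)"

lemma swap_last_swap_last [simp]: "swap_last (swap_last i) = i"
  by (simp add: swap_last_def)

text \<open>Reading \<open>\<eta>_c\<close> as the permutation matrix of a transposition turns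
  products with it into a relabelling of rows or columns.\<close>

lemma \<eta>_c_nth: "\<eta>_c $ i $ j = (if j = swap_last i then 1 else 0)"
  by (auto simp: \<eta>_c_def swap_last_def)

lemma \<eta>_c_nth': "\<eta>_c $ i $ j = (if i = swap_last j then 1 else 0)"
  by (auto simp: \<eta>_c_def swap_last_def)

lemma \<eta>_c_mult:
  "(\<eta>_c ** M) $ i $ j = M $ swap_last i $ j" "(M ** \<eta>_c) $ i $ j = M $ i $ swap_last j"
  by (simp add: matrix_matrix_mult_def \<eta>_c_nth if_distrib[of "\<lambda>x. x * _"] cong: if_cong)
     (simp add: matrix_matrix_mult_def \<eta>_c_nth' if_distrib[of "\<lambda>x. _ * x"] cong: if_cong)

lemma almost_abelian_\<eta>_c:
  "almost_abelian (\<eta>_c :: real^('m::{finite,linorder} option)^('m::{finite,linorder} option))"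
proof
  show "transpose \<eta>_c = (\<eta>_c :: real^('m option)^('m option))"
    by (simp add: vec_eq_iff transpose_nth) (metis \<eta>_c_nth \<eta>_c_nth')
  show "\<eta>_c ** \<eta>_c = (mat 1 :: real^('m option)^('m option))"
    by (auto simp: vec_eq_iff \<eta>_c_mult \<eta>_c_nth mat_def dest: arg_cong[of _ _ swap_last])
qed

text \<open>The corner entry of \<open>A\<close> stays arbitrary here; the values 0 and 1 enter only
  in the final theorem.\<close>

locale null_block =
  fixes A S' T' :: "real^'m::{finite,linorder}^'m::{finite,linorder}"
  assumes decomposition: "upper_left_block A = S' + T'" and S': "transpose S' = S'" and T': "transpose T' = - T'"
begin

sublocale almost_abelian A \<eta>_c
  by (rule almost_abelian_\<eta>_c)

abbreviation "b \<equiv> upper_right_block A"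
abbreviation "d \<equiv> corner_entry A"

lemma B\<^sub>0_nth: "B\<^sub>0 $ i $ j = N $ i $ j + N $ swap_last j $ swap_last i"
  by (simp add: B\<^sub>0_def \<eta>_c_mult transpose_nth)

lemma row_B\<^sub>0: "B\<^sub>0 $ None $ None = d" "B\<^sub>0 $ None $ Some i = b $ i"
  by (simp_all add: B\<^sub>0_nth swap_last_def N_def corner_entry_def upper_right_block_def)

lemma trace_T'_S': "trace (T' ** S') = 0"
proof -
  have "trace (T' ** S') = trace (transpose (T' ** S'))" by simp
  also have "\<dots> = - trace (T' ** S')"
    by (simp add: matrix_transpose_mul S' T' trace_mul_sym[of S'])
  finally show ?thesis by simp
qed

lemma trace_A: "trace A = trace S' + d"
proof -
  have "trace T' = trace (transpose T')" by simp
  then have "trace T' = 0" unfolding T' by simp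
  then have "trace (upper_left_block A) = trace S'" by (simp add: decomposition trace_add)
  moreover have "A $ i $ i = upper_left_block A $ i $ i + (if i = last_index then d else 0)" for i
    by (simp add: upper_left_block_def corner_entry_def)
  then have "trace A = trace (upper_left_block A) + d"
    by (simp add: trace_def sum.distrib)
  ultimately show ?thesis by simp
qed

text \<open>With \<open>B\<^sub>0 = N + Y\<close>, where \<open>Y\<close> is the adjoint of
  \<open>N\<close>, the squares of \<open>N\<close> and \<open>Y\<close> both have the trace of
  \<open>A ** A\<close>, and the cross terms are twice the trace of \<open>N ** Y\<close>. In
  combination the skew part \<open>T'\<close> drops out.\<close>

lemma trace_B\<^sub>0_B\<^sub>0:
  assumes "b = 0"
  shows "trace (B\<^sub>0 ** B\<^sub>0) = 4 * trace (S' ** S') + 2 * d\<^sup>2"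
proof -
  let ?A' = "upper_left_block A" and ?Y = "\<eta>_c ** transpose N ** \<eta>_c"
  have YY: "trace (?Y ** ?Y) = trace (A ** A)"
  proof -
    have "?Y ** ?Y = \<eta>_c ** (transpose N ** transpose N ** \<eta>_c)"
      by (simp add: matrix_mul_assoc) (simp add: matrix_mul_assoc[symmetric] \<eta>_involution matrix_mul_assoc[of \<eta>_c \<eta>_c])
    then have "trace (?Y ** ?Y) = trace (transpose N ** transpose N ** \<eta>_c ** \<eta>_c)"
      by (simp add: trace_mul_sym[of \<eta>_c])
    also have "\<dots> = trace (transpose (N ** N))"
      by (simp add: matrix_mul_assoc[symmetric] \<eta>_involution matrix_transpose_mul)
    finally show ?thesis by (simp add: N_def extend_mult)
  qed
  \<comment> \<open>The swap sends the last index of the block to \<open>None\<close>, where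
    \<open>N\<close> vanishes, so only the upper left block contributes.\<close>
  have NY: "trace (N ** ?Y) = trace (?A' ** transpose ?A')"
  proof -
    have "A $ i $ j * N $ swap_last (Some i) $ swap_last (Some j) = ?A' $ i $ j * ?A' $ i $ j" for i j
      by (simp add: swap_last_def N_def upper_left_block_def)
    moreover have "N $ None $ j = 0" "N $ i $ None = 0" "N $ Some k $ Some l = A $ k $ l" for i j k l
      by (simp_all add: N_def)
    ultimately show ?thesis
      by (simp add: trace_def matrix_matrix_mult_def[of N] matrix_matrix_mult_def[of ?A'] \<eta>_c_mult transpose_nth sum_option)
  qed
  have AA: "trace (A ** A) = trace (?A' ** ?A') + d\<^sup>2"
  proof -
    \<comment> \<open>Products of off-diagonal block entries always contain a factor from this
      column, so besides the upper left block only the square of \<open>d\<close> remains.\<close>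
    have b: "A $ i $ last_index = 0" if "i \<noteq> last_index" for i
      using arg_cong[OF assms, of "\<lambda>v. v $ i"] that by (simp add: upper_right_block_def)
    have "A $ i $ j * A $ j $ i = ?A' $ i $ j * ?A' $ j $ i +
        (if i = last_index then if j = last_index then d\<^sup>2 else 0 else 0)" for i j
      using b[of i] b[of j] by (auto simp: upper_left_block_def corner_entry_def power2_eq_square)
    then have "trace (A ** A) = trace (?A' ** ?A') +
        (\<Sum>i\<in>UNIV. \<Sum>j\<in>(UNIV :: 'm set). if i = (last_index :: 'm) then if j = last_index then d\<^sup>2 else 0 else 0)"
      by (simp add: trace_def matrix_matrix_mult_def sum.distrib)
    also have "(\<Sum>i\<in>UNIV. \<Sum>j\<in>(UNIV :: 'm set). if i = (last_index :: 'm) then if j = last_index then d\<^sup>2 else 0 else 0) =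
        (\<Sum>i\<in>UNIV. if i = (last_index :: 'm) then d\<^sup>2 else 0)"
      by (rule sum.cong) auto
    finally show ?thesis by simp
  qed
  have A'A': "trace (?A' ** ?A') + trace (?A' ** transpose ?A') = 2 * trace (S' ** S')"
  proof -
    have "trace (?A' ** ?A') + trace (?A' ** transpose ?A') = trace (?A' ** (?A' + transpose ?A'))"
      by (simp add: matrix_add_ldistrib trace_add)
    also have "?A' + transpose ?A' = 2 *\<^sub>R S'"
      by (simp add: decomposition S' T' vec_eq_iff)
    finally show ?thesis
      by (simp add: decomposition matrix_mult_add_left trace_add trace_T'_S')
  qed
  have "trace (B\<^sub>0 ** B\<^sub>0) = trace (N ** N) + trace (?Y ** N) + (trace (N ** ?Y) + trace (?Y ** ?Y))"
    unfolding B\<^sub>0_def by (simp only: matrix_add_ldistrib matrix_mult_add_left trace_add)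
  also have "trace (?Y ** N) = trace (N ** ?Y)" by (rule trace_mul_sym)
  also have "trace (N ** N) = trace (A ** A)" by (simp add: N_def extend_mult)
  finally show ?thesis using YY NY AA A'A' by simp
qed

text \<open>The corner of \<open>\<eta>_c\<close> is 0, which removes the commutator term, and the
  last row of \<open>B\<^sub>0\<close> is \<open>d\<close> times the unit row. Everything is then a
  multiple of one outer product, and the squares of \<open>d\<close> cancel.\<close>

lemma ricci_form_b_0:
  assumes "b = 0"
  shows "ricci_form = (2 * (d * trace S' - trace (S' ** S'))) *\<^sub>R outer (axis None 1) (axis None 1)"
proof -
  define e :: "real^('m option)" where "e = axis None 1"
  have row: "B\<^sub>0 $ None = d *\<^sub>R e"
    using assms by (simp add: vec_option_eq_iff row_B\<^sub>0 e_def axis_def)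
  have "(B\<^sub>0 ** N) $ None = 0"
    by (simp add: vec_eq_iff matrix_matrix_mult_def row sum_option N_def e_def axis_def)
  then have "ricci_form = (2 * (trace A * d) - trace (B\<^sub>0 ** B\<^sub>0) / 2 - d * d) *\<^sub>R outer e e"
    unfolding ricci_form_def Let_def e_def[symmetric] row
    by (simp add: vec_eq_iff \<eta>_c_nth swap_last_def algebra_simps)
  also have "2 * (trace A * d) - trace (B\<^sub>0 ** B\<^sub>0) / 2 - d * d = 2 * (d * trace S' - trace (S' ** S'))"
    by (simp add: trace_B\<^sub>0_B\<^sub>0[OF assms] trace_A power2_eq_square field_simps)
  finally show ?thesis by (simp add: e_def)
qed

lemma ricci_flat_iff_blocks:
  "ricci_flat (almost_abelian_metric A \<eta>_c) \<longleftrightarrow> b = 0 \<and> d * trace S' = trace (S' ** S')"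
proof -
  have "b = 0" if "ricci_form = 0"
  proof -
    \<comment> \<open>On these diagonal entries the terms with the unit row vanish, as does the term
      with the corner of \<open>\<eta>_c\<close>; only the square of the row of
      \<open>B\<^sub>0\<close> is left.\<close>
    have "ricci_form $ Some i $ Some i = - (b $ i * b $ i)" for i
      by (simp add: ricci_form_def Let_def axis_def row_B\<^sub>0 \<eta>_c_nth swap_last_def)
    then show ?thesis using that by (simp add: vec_eq_iff)
  qed
  moreover have "ricci_form = 0 \<longleftrightarrow> d * trace S' = trace (S' ** S')" if "b = 0"
  proof -
    have "outer (axis None 1) (axis None 1) \<noteq> (0 :: real^('m option)^('m option))"
      by (auto simp: vec_eq_iff axis_def intro!: exI[of _ None])
    then show ?thesis unfolding ricci_form_b_0[OF that] by simp
  qed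
  ultimately show ?thesis unfolding ricci_flat_iff by blast
qed

end

theorem corollary3p3:
  fixes A :: "real^'m::{finite,linorder}^'m::{finite,linorder}"
  shows
    "(\<forall>S T. A = S + T \<and> transpose S = S \<and> transpose T = - T \<longrightarrow>
        (ricci_flat (almost_abelian_metric A \<eta>_a) \<longleftrightarrow> S = 0)) \<and>
     (\<forall>S\<^sub>L T\<^sub>L. A = S\<^sub>L + T\<^sub>L
          \<and> transpose S\<^sub>L = J_minkowski ** S\<^sub>L ** J_minkowski
          \<and> transpose T\<^sub>L = - (J_minkowski ** T\<^sub>L ** J_minkowski) \<longrightarrow>
        (ricci_flat (almost_abelian_metric A \<eta>_b) \<longleftrightarrow>
           trace S\<^sub>L = 0 \<and> trace (S\<^sub>L ** S\<^sub>L) = 0 \<and>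
           isometric (almost_abelian_metric A \<eta>_b) (almost_abelian_metric S\<^sub>L \<eta>_b))) \<and>
     (\<forall>S' T' b d. upper_left_block A = S' + T'
          \<and> transpose S' = S' \<and> transpose T' = - T'
          \<and> b = upper_right_block A \<and> d = corner_entry A \<and> d \<in> {0, 1} \<longrightarrow>
        (ricci_flat (almost_abelian_metric A \<eta>_c) \<longleftrightarrow>
           b = 0 \<and> (d = 0 \<longrightarrow> S' = 0) \<and> (d = 1 \<longrightarrow> trace (S' ** S') = trace S')))"
proof (intro conjI allI impI)
  fix S T assume "A = S + T \<and> transpose S = S \<and> transpose T = - T"
  then show "ricci_flat (almost_abelian_metric A \<eta>_a) \<longleftrightarrow> S = 0"
    by (intro ricci_flat_case_a) auto
next
  fix S\<^sub>L T\<^sub>L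
  assume "A = S\<^sub>L + T\<^sub>L
      \<and> transpose S\<^sub>L = J_minkowski ** S\<^sub>L ** J_minkowski
      \<and> transpose T\<^sub>L = - (J_minkowski ** T\<^sub>L ** J_minkowski)"
  then show "ricci_flat (almost_abelian_metric A \<eta>_b) \<longleftrightarrow>
      trace S\<^sub>L = 0 \<and> trace (S\<^sub>L ** S\<^sub>L) = 0 \<and>
      isometric (almost_abelian_metric A \<eta>_b) (almost_abelian_metric S\<^sub>L \<eta>_b)"
    by (intro ricci_flat_case_b) auto
next
  fix S' T' b d
  assume *: "upper_left_block A = S' + T'
      \<and> transpose S' = S' \<and> transpose T' = - T'
      \<and> b = upper_right_block A \<and> d = corner_entry A \<and> d \<in> {0, 1}"
  then interpret null_block A S' T' by unfold_locales auto
  show "ricci_flat (almost_abelian_metric A \<eta>_c) \<longleftrightarrow>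
      b = 0 \<and> (d = 0 \<longrightarrow> S' = 0) \<and> (d = 1 \<longrightarrow> trace (S' ** S') = trace S')"
    \<comment> \<open>For \<open>d = 0\<close> the trace condition says that the square of
      \<open>S'\<close> is traceless, which for symmetric \<open>S'\<close> means
      \<open>S' = 0\<close>.\<close>
    using * ricci_flat_iff_blocks trace_square_symmetric[of S'] by auto
qed

end
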